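(* Let $\mathcal X$ be the configuration space of $N$ balls dropped into $d$ boxes. Let $$Q^\circ_{\boldsymbol n}(\boldsymbol x;\boldsymbol u)=\binom{N}{\boldsymbol n,N-|\boldsymbol n|}^{-1/2}Q_{\boldsymbol n}(\boldsymbol x;\boldsymbol u)$$ be the orthonormal multivariate Krawtchouk polynomials on the multinomial $(N,\boldsymbol p)$ distribution, based on the orthonormal basis $\{u^{(l)}\}$. Let $\widehat p(\boldsymbol x)$ be the empirical measure of $\boldsymbol X_1,\dots,\boldsymbol X_r$, a sample of size $r$ from $\mathcal X$, and let $\widetilde p(\boldsymbol n)=\sum_{\boldsymbol x}Q^\circ_{\boldsymbol n}(\boldsymbol x;\boldsymbol u)\,\widehat p(\boldsymbol x)$. Finally define, for $1\le i\le N$, $\widetilde p(i)^2=\sum_{\boldsymbol n:|\boldsymbol n|=i}|\widetilde p(\boldsymbol n)|^2$. Then $$\widetilde p(i)^2=\sum_{\boldsymbol x,\boldsymbol y}Q_i(\boldsymbol x,\boldsymbol y;N,\boldsymbol p)\,\widehat p(\boldsymbol x)\,\widehat p(\boldsymbol y),$$ and $$\sum_{i=1}^N r\,\widetilde p(i)^2=X^2(Nr),$$ where $X^2(Nr)$ is the chi-squared statistic based on dropping the $Nr$ balls into $d$ urns. A particular case of the formula for $\widetilde p(i)^2$ is $$r\,\widetilde p(1)^2=r\sum_{j=1}^d\frac{(\bar x_j-Np_j)^2}{Np_j},$$ a goodness of fit statistic for testing whether the proportions are correct. Under the null hypothesis (that the sample is drawn from the multinomial $(N,\boldsymbol p)$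 distribution), the $r\,\widetilde p(i)^2$ are asymptotically independent chi-squared components with $\binom{i+d-2}{d-2}$ degrees of freedom, $i=1,2,\dots,N$.
   Context: Notation: $\boldsymbol p=(p_1,\dots,p_d)$ is a probability distribution with $p_j>0$; $\mathcal X=\{\boldsymbol x\in\mathbb Z_+^d:|\boldsymbol x|=N\}$, $|\boldsymbol x|=\sum_jx_j$; the multinomial distribution is $m(\boldsymbol x;N,\boldsymbol p)=\frac{N!}{\prod_jx_j!}\prod_jp_j^{x_j}$; $\binom N{\boldsymbol n,N-|\boldsymbol n|}=N!/(n_1!\cdots n_{d-1}!\,(N-|\boldsymbol n|)!)$. The functions $u^{(0)}\equiv1,u^{(1)},\dots,u^{(d-1)}$ are a complete orthonormal set on $\{p_j\}_{j=1}^d$: $\sum_{j=1}^du^{(k)}_ju^{(l)}_jp_j=\delta_{kl}$. For $\boldsymbol n=(n_1,\dots,n_{d-1})\in\mathbb Z_+^{d-1}$ with $|\boldsymbol n|\le N$, $Q_{\boldsymbol n}(\boldsymbol x;\boldsymbol u)$ is the coefficient of $w_1^{n_1}\cdots w_{d-1}^{n_{d-1}}$ in $\prod_{j=1}^d\big(1+\sum_{l=1}^{d-1}w_lu^{(l)}_j\big)^{x_j}$; these are orthogonal on the multinomial $(N,\boldsymbol p)$ distribution with squared norm $\binom N{\boldsymbol n,N-|\boldsymbol n|}$. The reproducing kernel polynomials are $Q_i(\boldsymbol x,\boldsymbol y;N,\boldsymbol p)=\sum_{|\boldsymbol n|=i}Q^\circ_{\boldsymbol n}(\boldsymbol x;\boldsymbol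 u)Q^\circ_{\boldsymbol n}(\boldsymbol y;\boldsymbol u)$, which do not depend on the choice of $\boldsymbol u$. The empirical measure is $\widehat p(\boldsymbol x)=\#\{k:\boldsymbol X_k=\boldsymbol x\}/r$, and $\bar x_j=\sum_{\boldsymbol x}x_j\widehat p(\boldsymbol x)$ is the sample mean of the $j$th coordinate. In general, the chi-squared goodness of fit statistic for a sample of size $r$ from a finite set with hypothesised probabilities $p(x)$ is $\sum_x(N_x-rp(x))^2/(rp(x))$, where $N_x$ is the number of sample values equal to $x$.
   Formalization: X²(Nr) is taken as the chi-squared statistic of the r sampled configurations against the multinomial (N,p) probabilities; the statistic from pooling the Nr balls into d urns equals r p̃(1)² alone, so that the identity would fail for N ≥ 2. *)

theory Defs
  imports "HOL-Probability.Probability" "HOL-Library.Poly_Mapping"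
begin

text \<open>
  Vectors of length \<open>m\<close> with entries in the natural numbers are finitely supported functions on
  \<open>nat\<close> whose support lies in \<open>{1..m}\<close>. For \<open>m = d\<close>, \<open>k = N\<close> the set below is the configuration
  space of \<open>N\<close> balls in \<open>d\<close> boxes; for \<open>m = d - 1\<close> it is the set of multi-indices of total
  degree \<open>k\<close>.
\<close>

definition weak_comps :: "nat \<Rightarrow> nat \<Rightarrow> (nat \<Rightarrow>\<^sub>0 nat) set" where
  "weak_comps m k =
     {x. Poly_Mapping.keys x \<subseteq> {1..m} \<and> (\<Sum>j=1..m. Poly_Mapping.lookup x j) = k}"

definition multinomial :: "nat \<Rightarrow> nat \<Rightarrow> (nat \<Rightarrow> real) \<Rightarrow> (nat \<Rightarrow>\<^sub>0 nat) \<Rightarrow> real" where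
  "multinomial d N p x =
     fact N / (\<Prod>j=1..d. fact (Poly_Mapping.lookup x j))
       * (\<Prod>j=1..d. p j ^ Poly_Mapping.lookup x j)"

definition multinomial_measure :: "nat \<Rightarrow> nat \<Rightarrow> (nat \<Rightarrow> real) \<Rightarrow> (nat \<Rightarrow>\<^sub>0 nat) measure" where
  "multinomial_measure d N p =
     point_measure (weak_comps d N) (\<lambda>x. ennreal (multinomial d N p x))"

text \<open>
  \<open>u l j\<close> is the value at the point \<open>j\<close> of the \<open>l\<close>-th basis function. Completeness is automatic:
  these are \<open>d\<close> orthonormal functions on a set with \<open>d\<close> points.
\<close>

definition orthonormal_basis :: "nat \<Rightarrow> (nat \<Rightarrow> real) \<Rightarrow> (nat \<Rightarrow> nat \<Rightarrow> real) \<Rightarrow> bool" where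
  "orthonormal_basis d p u \<longleftrightarrow>
     (\<forall>j\<in>{1..d}. u 0 j = 1) \<and>
     (\<forall>k\<in>{0..d-1}. \<forall>l\<in>{0..d-1}. (\<Sum>j=1..d. u k j * u l j * p j) = (if k = l then 1 else 0))"

text \<open>
  Real polynomials in the variables \<open>w\<^sub>1, w\<^sub>2, \<dots>\<close> are elements of the monoid algebra
  \<^typ>\<open>(nat \<Rightarrow>\<^sub>0 nat) \<Rightarrow>\<^sub>0 real\<close> (finitely supported coefficient functions on exponent vectors,
  with the convolution product of \<^theory>\<open>HOL-Library.Poly_Mapping\<close>); the monomial
  \<open>c w\<^sub>l\<close> is \<open>single (single l 1) c\<close>.
\<close>

definition krawtchouk_gen ::
    "nat \<Rightarrow> (nat \<Rightarrow> nat \<Rightarrow> real) \<Rightarrow> (nat \<Rightarrow>\<^sub>0 nat) \<Rightarrow> ((nat \<Rightarrow>\<^sub>0 nat) \<Rightarrow>\<^sub>0 real)" where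
  "krawtchouk_gen d u x =
     (\<Prod>j=1..d. (1 + (\<Sum>l=1..d-1. Poly_Mapping.single (Poly_Mapping.single l 1) (u l j)))
                  ^ Poly_Mapping.lookup x j)"

definition krawtchouk ::
    "nat \<Rightarrow> (nat \<Rightarrow> nat \<Rightarrow> real) \<Rightarrow> (nat \<Rightarrow>\<^sub>0 nat) \<Rightarrow> (nat \<Rightarrow>\<^sub>0 nat) \<Rightarrow> real" where
  "krawtchouk d u n x = Poly_Mapping.lookup (krawtchouk_gen d u x) n"

definition index_coeff :: "nat \<Rightarrow> nat \<Rightarrow> (nat \<Rightarrow>\<^sub>0 nat) \<Rightarrow> real" where
  "index_coeff d N n =
     fact N / ((\<Prod>l=1..d-1. fact (Poly_Mapping.lookup n l))
                 * fact (N - (\<Sum>l=1..d-1. Poly_Mapping.lookup n l)))"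

definition krawtchouk_on ::
    "nat \<Rightarrow> nat \<Rightarrow> (nat \<Rightarrow> nat \<Rightarrow> real) \<Rightarrow> (nat \<Rightarrow>\<^sub>0 nat) \<Rightarrow> (nat \<Rightarrow>\<^sub>0 nat) \<Rightarrow> real" where
  "krawtchouk_on d N u n x = index_coeff d N n powr (- 1 / 2) * krawtchouk d u n x"

text \<open>
  The kernel does not depend on the orthonormal basis from which it is computed; it may therefore
  be formed from a basis other than the one used for the transform of the empirical measure.
\<close>

definition krawtchouk_kernel ::
    "nat \<Rightarrow> nat \<Rightarrow> (nat \<Rightarrow> nat \<Rightarrow> real) \<Rightarrow> nat \<Rightarrow> (nat \<Rightarrow>\<^sub>0 nat) \<Rightarrow> (nat \<Rightarrow>\<^sub>0 nat) \<Rightarrow> real" where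
  "krawtchouk_kernel d N u i x y =
     (\<Sum>n\<in>weak_comps (d - 1) i. krawtchouk_on d N u n x * krawtchouk_on d N u n y)"

definition sample_count :: "nat \<Rightarrow> (nat \<Rightarrow> 'a) \<Rightarrow> 'a \<Rightarrow> nat" where
  "sample_count r X x = card {k \<in> {1..r}. X k = x}"

definition emp :: "nat \<Rightarrow> (nat \<Rightarrow> 'a) \<Rightarrow> 'a \<Rightarrow> real" where
  "emp r X x = real (sample_count r X x) / real r"

definition sample_mean :: "nat \<Rightarrow> nat \<Rightarrow> nat \<Rightarrow> (nat \<Rightarrow> (nat \<Rightarrow>\<^sub>0 nat)) \<Rightarrow> nat \<Rightarrow> real" where
  "sample_mean d N r X j =
     (\<Sum>x\<in>weak_comps d N. real (Poly_Mapping.lookup x j) * emp r X x)"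

definition emp_transform ::
    "nat \<Rightarrow> nat \<Rightarrow> (nat \<Rightarrow> nat \<Rightarrow> real) \<Rightarrow> nat \<Rightarrow> (nat \<Rightarrow> (nat \<Rightarrow>\<^sub>0 nat)) \<Rightarrow> (nat \<Rightarrow>\<^sub>0 nat) \<Rightarrow> real" where
  "emp_transform d N u r X n = (\<Sum>x\<in>weak_comps d N. krawtchouk_on d N u n x * emp r X x)"

definition emp_power ::
    "nat \<Rightarrow> nat \<Rightarrow> (nat \<Rightarrow> nat \<Rightarrow> real) \<Rightarrow> nat \<Rightarrow> (nat \<Rightarrow> (nat \<Rightarrow>\<^sub>0 nat)) \<Rightarrow> nat \<Rightarrow> real" where
  "emp_power d N u r X i = (\<Sum>n\<in>weak_comps (d - 1) i. \<bar>emp_transform d N u r X n\<bar>\<^sup>2)"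

definition chi_square_stat :: "'a set \<Rightarrow> ('a \<Rightarrow> real) \<Rightarrow> nat \<Rightarrow> (nat \<Rightarrow> 'a) \<Rightarrow> real" where
  "chi_square_stat S q r X =
     (\<Sum>x\<in>S. (real (sample_count r X x) - real r * q x)\<^sup>2 / (real r * q x))"

definition chi_squared_distribution :: "nat \<Rightarrow> real measure" where
  "chi_squared_distribution k =
     distr (\<Pi>\<^sub>M i\<in>{..<k}. std_normal_distribution) borel (\<lambda>z. \<Sum>i<k. (z i)\<^sup>2)"

text \<open>
  The following two definitions are the analogues of \<^const>\<open>cdf\<close> and \<^const>\<open>weak_conv_m\<close> for
  measures on \<open>\<Pi>\<^sub>M i\<in>I. borel\<close>: convergence of the joint distribution functions at every point of
  continuity of the limiting one. Joint convergence to a product measure expresses asymptotic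
  independence of the coordinates.
\<close>

definition joint_cdf :: "'i::countable set \<Rightarrow> ('i \<Rightarrow> real) measure \<Rightarrow> ('i \<Rightarrow> real) \<Rightarrow> real" where
  "joint_cdf I M t = measure M {y \<in> space M. \<forall>i\<in>I. y i \<le> t i}"

definition joint_weak_conv ::
    "'i::countable set \<Rightarrow> (nat \<Rightarrow> ('i \<Rightarrow> real) measure) \<Rightarrow> ('i \<Rightarrow> real) measure \<Rightarrow> bool" where
  "joint_weak_conv I Ms M \<longleftrightarrow>
     (\<forall>t. isCont (joint_cdf I M) t \<longrightarrow> (\<lambda>r. joint_cdf I (Ms r) t) \<longlonglongrightarrow> joint_cdf I M t)"

end

theory Submission
  imports Defs "HOL-Combinatorics.Multiset_Permutations" "HOL-Computational_Algebra.Polynomial"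
begin

text \<open>
  A configuration with \<open>N\<close> balls is the type of a word \<open>a\<close> of length \<open>N\<close> over the boxes, and a
  multi-index \<open>n\<close> with \<open>|n| \<le> N\<close> is the type of a word \<open>b\<close> over \<open>{0..d-1}\<close>. Expanding the generating
  function letter by letter, the Krawtchouk polynomial is the sum of \<open>\<Prod>k. u (b k) (a k)\<close> over the
  words \<open>b\<close> of type \<open>n\<close>, so that orthonormality reduces to that of \<open>u\<close> in each letter. Likewise the
  kernel of degree \<open>i\<close> is the average over the words \<open>a\<close> of type \<open>x\<close> of the \<open>i\<close>-th coefficient of
  \<open>\<Prod>k. 1 + t R (a k) (a' k)\<close>, where \<open>R j j' = \<delta> j j' / p j - 1\<close> does not involve the basis; at
  \<open>t = 1\<close> this gives completeness, hence the chi-squared identity.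

  For the limit law, the values \<open>exp (- r p~(i)\<^sup>2)\<close> lie in \<open>[0, 1]\<close>, so by Weierstrass approximation
  it suffices that their joint moments converge. Such a moment is the expectation of a Gaussian
  function of the normalised sums, which is a Gaussian mixture of their characteristic function,
  and this converges by the one-dimensional central limit theorem.
\<close>

subsection \<open>Joint convergence from Laplace transforms\<close>

text \<open>Behind the word expansions stands a tensor power: under the product of \<open>N\<close>
  copies of \<open>p\<close>, the functions \<open>U b\<close> on words are orthonormal.
  Configurations and multi-indices are orbits of words under permutation of positions, and a
  Krawtchouk polynomial is the sum of \<open>U b\<close> over one orbit. Its squared norm is
  therefore an orbit size, which is \<open>index_coeff\<close>. For the limit law, the polynomials
  of degree at least 1 are orthonormal and orthogonal to the constant 1, so their normalised sample
  sums have mean 0 and identity covariance. Different degrees use disjoint sets of these sums, hence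
  the independence; the degrees of freedom count the multi-indices of one degree. The substitution
  \<open>exp (- y)\<close> maps the half line into a bounded interval, so polynomial approximation
  is uniform there and no separate tightness argument enters. It also suits sums of squares: powers
  of \<open>exp (- y)\<close> split into one Gaussian factor per multi-index. The remaining obstacle
  is that distribution functions integrate discontinuous indicators; continuous ramps squeeze them,
  and continuity of the limit at \<open>t\<close> closes the gap.\<close>

lemma unit_interval_polynomial_approx:
  fixes h :: "real \<Rightarrow> real"
  assumes cont: "continuous_on {0..1} h"
    and bd: "\<And>y. y \<in> {0..1} \<Longrightarrow> \<bar>h y\<bar> \<le> 1"
    and "0 < e"
  obtains a n where "\<And>y. y \<in> {0..1} \<Longrightarrow> \<bar>h y - (\<Sum>k\<le>n. a k * y ^ k)\<bar> < e"
    and "\<And>y. y \<in> {0..1} \<Longrightarrow> \<bar>\<Sum>k\<le>n. a k * y ^ k\<bar> \<le> 1"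
proof -
  obtain g where g: "real_polynomial_function g" "\<And>y. y \<in> {0..1} \<Longrightarrow> \<bar>h y - g y\<bar> < e / 2"
    using Stone_Weierstrass_real_polynomial_function[OF compact_Icc cont, of "e / 2"] \<open>0 < e\<close> by auto
  then obtain a n where gn: "g = (\<lambda>x. \<Sum>k\<le>n. a k * x ^ k)"
    unfolding real_polynomial_function_iff_sum by blast
  \<comment> \<open>The approximant \<open>g\<close> may leave [-1, 1] by up to
    \<open>e / 2\<close>. Rescaling by \<open>1 + e / 2\<close> brings it back and costs at most
    another \<open>e / 2\<close>; the bound 1 is what later allows products to be compared factor by
    factor.\<close>
  define b where "b k = a k / (1 + e / 2)" for k
  have b: "(\<Sum>k\<le>n. b k * y ^ k) = g y / (1 + e / 2)" for y
    by (simp add: gn b_def sum_divide_distrib)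
  have g1: "\<bar>g y\<bar> \<le> 1 + e / 2" if "y \<in> {0..1}" for y
    using g(2)[OF that] bd[OF that] by linarith
  have "\<bar>h y - g y / (1 + e / 2)\<bar> < e" if y: "y \<in> {0..1}" for y
  proof -
    have "g y - g y / (1 + e / 2) = g y / (1 + e / 2) * (e / 2)"
      using \<open>0 < e\<close> by (simp add: field_simps)
    moreover have "\<bar>g y / (1 + e / 2)\<bar> \<le> 1" using g1[OF y] \<open>0 < e\<close> by simp
    hence "\<bar>g y / (1 + e / 2) * (e / 2)\<bar> \<le> 1 * (e / 2)" unfolding abs_mult
      using \<open>0 < e\<close> by (intro mult_mono) auto
    ultimately show ?thesis using g(2)[OF y] by linarith
  qed
  moreover have "\<bar>g y / (1 + e / 2)\<bar> \<le> 1" if "y \<in> {0..1}" for y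
    using g1[OF that] \<open>0 < e\<close> by simp
  ultimately show thesis using that[of b n] by (simp add: b)
qed

text \<open>A product of polynomials in the \<open>exp (- y i)\<close> is a finite linear
  combination of the moments in \<open>laplace\<close>, so its integral converges. Nonnegativity of
  \<open>y\<close> puts the arguments into [0, 1], where polynomials approximate \<open>h i\<close>;
  as all factors are bounded by 1, the errors of the factors merely add up.\<close>

lemma tendsto_integral_prod_of_laplace:
  fixes Ms :: "nat \<Rightarrow> ('i \<Rightarrow> real) measure"
  assumes "finite I"
    and Ms: "\<And>r. prob_space (Ms r)" "\<And>r. sets (Ms r) = sets (\<Pi>\<^sub>M i\<in>I. borel)"
      "\<And>r. AE y in Ms r. \<forall>i\<in>I. 0 \<le> y i"
    and M: "prob_space M" "sets M = sets (\<Pi>\<^sub>M i\<in>I. borel)" "AE y in M. \<forall>i\<in>I. 0 \<le> y i"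
    and laplace: "\<And>k :: 'i \<Rightarrow> nat. (\<lambda>r. \<integral>y. (\<Prod>i\<in>I. exp (- y i) ^ k i) \<partial>Ms r)
      \<longlonglongrightarrow> (\<integral>y. (\<Prod>i\<in>I. exp (- y i) ^ k i) \<partial>M)"
    and cont: "\<And>i. i \<in> I \<Longrightarrow> continuous_on UNIV (h i)"
    and bd: "\<And>i y. i \<in> I \<Longrightarrow> \<bar>h i y\<bar> \<le> (1 :: real)"
  shows "(\<lambda>r. \<integral>y. (\<Prod>i\<in>I. h i (exp (- y i))) \<partial>Ms r) \<longlonglongrightarrow> (\<integral>y. (\<Prod>i\<in>I. h i (exp (- y i))) \<partial>M)"
proof (rule metric_LIMSEQ_I)
  fix e :: real assume "0 < e"
  \<comment> \<open>There are \<open>card I\<close> factors, each with error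
    \<open>\<delta>\<close>, for a total of at most \<open>e / 3\<close>; the added 1 covers an
    empty \<open>I\<close>.\<close>
  define \<delta> where "\<delta> = e / (3 * (real (card I) + 1))"
  have "\<delta> > 0" using \<open>0 < e\<close> by (simp add: \<delta>_def)
  have "\<exists>a n. (\<forall>y\<in>{0..1}. \<bar>h i y - (\<Sum>k\<le>n. a k * y ^ k)\<bar> < \<delta>) \<and> (\<forall>y\<in>{0..1}. \<bar>\<Sum>k\<le>n. a k * y ^ k\<bar> \<le> 1)"
    if "i \<in> I" for i
    using unit_interval_polynomial_approx[of "h i" \<delta>] bd[OF that] \<open>\<delta> > 0\<close>
      continuous_on_subset[OF cont[OF that]] by (metis subset_UNIV)
  then obtain a n where
    app: "\<And>i y. i \<in> I \<Longrightarrow> y \<in> {0..1} \<Longrightarrow> \<bar>h i y - (\<Sum>k\<le>n i. a i k * y ^ k)\<bar> < \<delta>"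
    and app1: "\<And>i y. i \<in> I \<Longrightarrow> y \<in> {0..1} \<Longrightarrow> \<bar>\<Sum>k\<le>n i. a i k * y ^ k\<bar> \<le> 1"
    by metis
  define P where "P i y = (\<Sum>k\<le>n i. a i k * y ^ k)" for i y
  define H where "H = (\<lambda>y :: 'i \<Rightarrow> real. \<Prod>i\<in>I. h i (exp (- y i)))"
  define Q where "Q = (\<lambda>y :: 'i \<Rightarrow> real. \<Prod>i\<in>I. P i (exp (- y i)))"
  define G where "G = (\<lambda>(g :: 'i \<Rightarrow> nat) (y :: 'i \<Rightarrow> real). \<Prod>i\<in>I. exp (- y i) ^ g i)"
  have hm: "h i \<in> borel_measurable borel" if "i \<in> I" for i
    using cont[OF that] by (rule borel_measurable_continuous_onI)
  have meas: "H \<in> borel_measurable (\<Pi>\<^sub>M i\<in>I. borel)" "Q \<in> borel_measurable (\<Pi>\<^sub>M i\<in>I. borel)"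
    "G g \<in> borel_measurable (\<Pi>\<^sub>M i\<in>I. borel)" for g
    unfolding H_def Q_def P_def G_def using hm by measurable
  have Q_sum: "Q y = (\<Sum>g\<in>(\<Pi>\<^sub>E i\<in>I. {..n i}). (\<Prod>i\<in>I. a i (g i)) * G g y)" for y
    unfolding Q_def P_def G_def using \<open>finite I\<close> by (subst prod_sum_PiE) (auto simp: prod.distrib)
  \<comment> \<open>Stated for an arbitrary law \<open>L\<close> because the same polynomials must
    serve every \<open>Ms r\<close> and the limit \<open>M\<close>. These two replacements and the
    convergence of the integrals of \<open>Q\<close> cost \<open>e / 3\<close> each.\<close>
  have core: "(\<integral>y. Q y \<partial>L) = (\<Sum>g\<in>(\<Pi>\<^sub>E i\<in>I. {..n i}). (\<Prod>i\<in>I. a i (g i)) * (\<integral>y. G g y \<partial>L)) \<and>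
      \<bar>(\<integral>y. H y \<partial>L) - (\<integral>y. Q y \<partial>L)\<bar> \<le> e / 3"
    if L: "prob_space L" "sets L = sets (\<Pi>\<^sub>M i\<in>I. borel)" "AE y in L. \<forall>i\<in>I. 0 \<le> y i" for L
  proof -
    interpret L: prob_space L by fact
    have [measurable]: "H \<in> borel_measurable L" "Q \<in> borel_measurable L" "G g \<in> borel_measurable L" for g
      using meas measurable_cong_sets[OF L(2) refl] by blast+
    have AE01: "AE y in L. \<forall>i\<in>I. exp (- y i) \<in> {0..1}"
      using L(3) by eventually_elim auto
    have iG: "integrable L (G g)" for g
    proof (rule L.integrable_const_bound[of _ 1])
      show "AE y in L. norm (G g y) \<le> 1"
        using AE01 by eventually_elim (auto simp: G_def abs_prod intro!: prod_le_1 power_le_one)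
    qed measurable
    have iQ: "integrable L Q" 
    proof (rule L.integrable_const_bound[of _ 1])
      show "AE y in L. norm (Q y) \<le> 1"
        using AE01 by eventually_elim (auto simp: Q_def abs_prod P_def intro!: prod_le_1 app1)
    qed measurable
    have iH: "integrable L H" 
    proof (rule L.integrable_const_bound[of _ 1])
      show "AE y in L. norm (H y) \<le> 1"
        by (auto simp: H_def abs_prod intro!: prod_le_1 bd)
    qed measurable
    have HQ: "AE y in L. \<bar>H y - Q y\<bar> \<le> e / 3"
      using AE01
    proof eventually_elim
      case (elim y)
      have "\<bar>H y - Q y\<bar> \<le> (\<Sum>i\<in>I. \<bar>h i (exp (- y i)) - P i (exp (- y i))\<bar>)"
        unfolding H_def Q_def real_norm_def[symmetric]
        by (rule norm_prod_diff) (use elim bd app1 in \<open>auto simp: P_def\<close>)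
      also have "\<dots> \<le> (\<Sum>i\<in>I. \<delta>)"
        using elim app by (intro sum_mono less_imp_le) (auto simp: P_def)
      also have "\<dots> \<le> e / 3" using \<open>0 < e\<close> by (simp add: \<delta>_def field_simps)
      finally show ?case .
    qed
    have "\<bar>\<integral>y. H y - Q y \<partial>L\<bar> \<le> (\<integral>y. \<bar>H y - Q y\<bar> \<partial>L)" by (rule integral_abs_bound)
    also have "\<dots> \<le> (\<integral>y. e / 3 \<partial>L)" using iH iQ HQ by (intro integral_mono_AE) auto
    also have "\<dots> = e / 3" by (simp add: L.prob_space)
    finally have "\<bar>(\<integral>y. H y \<partial>L) - (\<integral>y. Q y \<partial>L)\<bar> \<le> e / 3" using iH iQ by simp
    moreover have "(\<integral>y. Q y \<partial>L) = (\<Sum>g\<in>(\<Pi>\<^sub>E i\<in>I. {..n i}). (\<Prod>i\<in>I. a i (g i)) * (\<integral>y. G g y \<partial>L))"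
      unfolding Q_sum using iG by (simp add: Bochner_Integration.integral_sum)
    ultimately show ?thesis by simp
  qed
  have "(\<lambda>r. \<integral>y. Q y \<partial>Ms r) \<longlonglongrightarrow> (\<integral>y. Q y \<partial>M)"
    using core[OF Ms] core[OF M] laplace by (auto simp: G_def intro!: tendsto_intros)
  then obtain R where R: "\<And>r. r \<ge> R \<Longrightarrow> \<bar>(\<integral>y. Q y \<partial>Ms r) - (\<integral>y. Q y \<partial>M)\<bar> < e / 3"
    using \<open>0 < e\<close> by (force simp: LIMSEQ_iff dest: spec[of _ "e / 3"])
  have "\<bar>(\<integral>y. H y \<partial>Ms r) - (\<integral>y. H y \<partial>M)\<bar> < e" if "r \<ge> R" for r
    using R[OF that] core[OF Ms, of r] core[OF M] by (auto simp: abs_if split: if_splits)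
  thus "\<exists>R. \<forall>r\<ge>R. dist (\<integral>y. (\<Prod>i\<in>I. h i (exp (- y i))) \<partial>Ms r) (\<integral>y. (\<Prod>i\<in>I. h i (exp (- y i))) \<partial>M) < e"
    unfolding H_def dist_real_def by blast
qed

text \<open>The indicator of an orthant is squeezed between products of continuous ramps in the
  variables \<open>exp (- y i)\<close>, to which the previous lemma applies. The price is a small
  shift of \<open>t\<close>, which vanishes in the limit because the limiting distribution function
  is continuous at \<open>t\<close>.\<close>

lemma joint_weak_conv_of_laplace:
  fixes Ms :: "nat \<Rightarrow> ('i::countable \<Rightarrow> real) measure"
  assumes "finite I"
    and Ms: "\<And>r. prob_space (Ms r)" "\<And>r. sets (Ms r) = sets (\<Pi>\<^sub>M i\<in>I. borel)"
      "\<And>r. AE y in Ms r. \<forall>i\<in>I. 0 \<le> y i"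
    and M: "prob_space M" "sets M = sets (\<Pi>\<^sub>M i\<in>I. borel)" "AE y in M. \<forall>i\<in>I. 0 \<le> y i"
    and laplace: "\<And>k :: 'i \<Rightarrow> nat. (\<lambda>r. \<integral>y. (\<Prod>i\<in>I. exp (- y i) ^ k i) \<partial>Ms r)
      \<longlonglongrightarrow> (\<integral>y. (\<Prod>i\<in>I. exp (- y i) ^ k i) \<partial>M)"
  shows "joint_weak_conv I Ms M"
  unfolding joint_weak_conv_def
proof (intro allI impI)
  fix t :: "'i \<Rightarrow> real" assume cont: "isCont (joint_cdf I M) t"
  \<comment> \<open>The map \<open>y\<close> to \<open>exp (- y)\<close> reverses order, so
    \<open>y i \<le> t i + s\<close> is a lower bound on \<open>exp (- y i)\<close>. The ramp
    therefore rises from 0 at the image of the larger shift \<open>s'\<close> to 1 at the image of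
    the smaller shift \<open>s\<close>.\<close>
  define ramp where "ramp \<alpha> \<beta> y = max 0 (min 1 ((y - \<alpha>) / (\<beta> - \<alpha>)))" for \<alpha> \<beta> y :: real
  define H where "H s s' = (\<lambda>y :: 'i \<Rightarrow> real. \<Prod>i\<in>I. ramp (exp (- (t i + s'))) (exp (- (t i + s))) (exp (- y i)))" for s s'
  have sandwich: "joint_cdf I L (\<lambda>i. t i + s) \<le> (\<integral>y. H s s' y \<partial>L) \<and>
      (\<integral>y. H s s' y \<partial>L) \<le> joint_cdf I L (\<lambda>i. t i + s')"
    if L: "prob_space L" "sets L = sets (\<Pi>\<^sub>M i\<in>I. borel)" and "s < s'" for L s s'
  proof -
    interpret L: prob_space L by fact
    have Hm: "H s s' \<in> borel_measurable (\<Pi>\<^sub>M i\<in>I. borel)"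
      unfolding H_def ramp_def by measurable
    have [measurable]: "H s s' \<in> borel_measurable L"
      using Hm measurable_cong_sets[OF L(2) refl] by blast
    define A where "A x = {y \<in> space L. \<forall>i\<in>I. y i \<le> t i + x}" for x
    have A: "A x \<in> sets L" for x
    proof -
      have "{y \<in> space (\<Pi>\<^sub>M i\<in>I. borel). \<forall>i\<in>I. y i \<le> t i + x} \<in> sets (\<Pi>\<^sub>M i\<in>I. borel)"
        using \<open>finite I\<close> by measurable
      thus ?thesis by (simp add: A_def L(2) sets_eq_imp_space_eq[OF L(2)])
    qed
    have r01: "0 \<le> ramp \<alpha> \<beta> y" "ramp \<alpha> \<beta> y \<le> 1" for \<alpha> \<beta> y by (auto simp: ramp_def)
    have r1: "ramp \<alpha> \<beta> y = 1" if "\<alpha> < \<beta>" "\<beta> \<le> y" for \<alpha> \<beta> y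
      using that by (auto simp: ramp_def field_simps)
    have r0: "ramp \<alpha> \<beta> y = 0" if "\<alpha> < \<beta>" "y \<le> \<alpha>" for \<alpha> \<beta> y
      using that by (auto simp: ramp_def field_simps)
    have H01: "0 \<le> H s s' y" "H s s' y \<le> 1" for y
      unfolding H_def by (auto intro!: prod_nonneg prod_le_1 r01)
    have iH: "integrable L (H s s')"
      by (rule L.integrable_const_bound[of _ 1]) (use H01 in auto)
    have "indicator (A s) y \<le> H s s' y" for y
    proof (cases "y \<in> A s")
      case True
      then have "H s s' y = (\<Prod>i\<in>I. 1)"
        unfolding H_def using \<open>s < s'\<close> by (intro prod.cong refl r1) (auto simp: A_def)
      thus ?thesis by (simp add: True)
    qed (simp add: H01)
    moreover have "H s s' y \<le> indicator (A s') y" if y: "y \<in> space L" for y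
    proof (cases "y \<in> A s'")
      case False
      then obtain i where "i \<in> I" "y i > t i + s'" using y by (auto simp: A_def not_le)
      then have "ramp (exp (- (t i + s'))) (exp (- (t i + s))) (exp (- y i)) = 0"
        using \<open>s < s'\<close> by (intro r0) auto
      then have "H s s' y = 0" unfolding H_def using \<open>finite I\<close> \<open>i \<in> I\<close> by (intro prod_zero) auto
      thus ?thesis by simp
    qed (simp add: H01)
    moreover have "integrable L (indicator (A x) :: _ \<Rightarrow> real)" for x
      using A by (simp add: L.emeasure_eq_measure)
    ultimately have "(\<integral>y. indicator (A s) y \<partial>L) \<le> (\<integral>y. H s s' y \<partial>L) \<and>
      (\<integral>y. H s s' y \<partial>L) \<le> (\<integral>y. indicator (A s') y \<partial>L)"
      using iH by (intro conjI integral_mono) blast+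
    thus ?thesis using A by (simp add: joint_cdf_def A_def[symmetric] inf_absorb2 sets.sets_into_space)
  qed
  have conv: "(\<lambda>r. \<integral>y. H s s' y \<partial>Ms r) \<longlonglongrightarrow> (\<integral>y. H s s' y \<partial>M)" if "s < s'" for s s'
    unfolding H_def
    by (rule tendsto_integral_prod_of_laplace[OF \<open>finite I\<close> Ms M laplace])
       (use that in \<open>auto simp: ramp_def intro!: continuous_intros\<close>)
  \<comment> \<open>Continuity of the joint distribution function is used along the diagonal only,
    where every coordinate of \<open>t\<close> moves by the same amount.\<close>
  have tends: "((\<lambda>s. joint_cdf I M (\<lambda>i. t i + s)) \<longlongrightarrow> joint_cdf I M t) (at 0)"
  proof -
    have "continuous_on UNIV (\<lambda>s::real. (\<lambda>i. t i + s))"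
      by (intro continuous_intros)
    hence "((\<lambda>s::real. (\<lambda>i. t i + s)) \<longlongrightarrow> (\<lambda>i. t i + 0)) (at 0)"
      unfolding continuous_on_def by (metis UNIV_I)
    hence "((\<lambda>s::real. (\<lambda>i. t i + s)) \<longlongrightarrow> t) (at 0)" by simp
    thus ?thesis by (rule isCont_tendsto_compose[OF cont])
  qed
  show "(\<lambda>r. joint_cdf I (Ms r) t) \<longlonglongrightarrow> joint_cdf I M t"
  proof (rule metric_LIMSEQ_I)
    fix e :: real assume "0 < e"
    then have "e / 2 > 0" by simp
    obtain \<delta> where "\<delta> > 0" and \<delta>: "\<And>s. s \<noteq> 0 \<Longrightarrow> \<bar>s\<bar> < \<delta> \<Longrightarrow>
        \<bar>joint_cdf I M (\<lambda>i. t i + s) - joint_cdf I M t\<bar> < e / 2"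
      using tends[unfolded tendsto_iff, rule_format, OF \<open>e / 2 > 0\<close>]
      by (auto simp: eventually_at dist_real_def)
    \<comment> \<open>\<open>H 0 s\<close> bounds the distribution function at \<open>t\<close> from
      above and reaches at most \<open>t + s\<close>; \<open>H (- s) 0\<close> bounds it from below
      and reaches at least \<open>t - s\<close>. Half of \<open>e\<close> pays for the convergence
      of the integrals, the other half for the shift.\<close>
    define s where "s = \<delta> / 2"
    have s: "s > 0" "\<bar>joint_cdf I M (\<lambda>i. t i + s) - joint_cdf I M t\<bar> < e / 2"
        "\<bar>joint_cdf I M (\<lambda>i. t i + (- s)) - joint_cdf I M t\<bar> < e / 2"
      using \<open>\<delta> > 0\<close> \<delta>[of s] \<delta>[of "- s"] by (auto simp: s_def)
    have "\<forall>\<^sub>F r in sequentially. \<bar>(\<integral>y. H 0 s y \<partial>Ms r) - (\<integral>y. H 0 s y \<partial>M)\<bar> < e / 2"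
      "\<forall>\<^sub>F r in sequentially. \<bar>(\<integral>y. H (- s) 0 y \<partial>Ms r) - (\<integral>y. H (- s) 0 y \<partial>M)\<bar> < e / 2"
      using conv[of 0 s, THEN tendstoD, OF _ \<open>e / 2 > 0\<close>] conv[of "- s" 0, THEN tendstoD, OF _ \<open>e / 2 > 0\<close>]
        \<open>s > 0\<close> unfolding dist_real_def by auto
    hence "\<forall>\<^sub>F r in sequentially. dist (joint_cdf I (Ms r) t) (joint_cdf I M t) < e"
    proof eventually_elim
      case (elim r)
      show ?case
        using elim s sandwich[OF Ms(1,2), of 0 s r] sandwich[OF Ms(1,2), of "- s" 0 r]
          sandwich[OF M(1,2), of 0 s] sandwich[OF M(1,2), of "- s" 0]
        by (auto simp: dist_real_def abs_if split: if_splits)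
    qed
    thus "\<exists>R. \<forall>r\<ge>R. dist (joint_cdf I (Ms r) t) (joint_cdf I M t) < e"
      by (simp add: eventually_sequentially)
  qed
qed

subsection \<open>Gaussian averages and the central limit theorem\<close>

lemma integral_iexp_std_normal_PiM:
  fixes s :: "'b \<Rightarrow> real"
  assumes "finite B"
  shows "(\<integral>g. iexp (\<Sum>n\<in>B. s n * g n) \<partial>(\<Pi>\<^sub>M n\<in>B. std_normal_distribution))
    = of_real (exp (- (\<Sum>n\<in>B. (s n)\<^sup>2) / 2))"
proof -
  interpret N: real_distribution std_normal_distribution by (rule real_dist_normal_dist)
  interpret product_sigma_finite "\<lambda>_ :: 'b. std_normal_distribution"
    by standard
  have "(\<integral>g. iexp (\<Sum>n\<in>B. s n * g n) \<partial>(\<Pi>\<^sub>M n\<in>B. std_normal_distribution))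
      = (\<integral>g. (\<Prod>n\<in>B. iexp (s n * g n)) \<partial>(\<Pi>\<^sub>M n\<in>B. std_normal_distribution))"
    using assms by (simp add: exp_sum sum_distrib_left)
  also have "\<dots> = (\<Prod>n\<in>B. \<integral>x. iexp (s n * x) \<partial>std_normal_distribution)"
    using assms
  proof (rule product_integral_prod)
    show "integrable std_normal_distribution (\<lambda>x. iexp (s n * x))" for n
      by (rule N.integrable_const_bound[of _ 1]) auto
  qed
  also have "\<dots> = (\<Prod>n\<in>B. of_real (exp (- (s n)\<^sup>2 / 2)))"
    using fun_cong[OF char_std_normal_distribution] by (simp add: char_def)
  also have "\<dots> = of_real (exp (- (\<Sum>n\<in>B. (s n)\<^sup>2) / 2))"
    using assms by (simp add: exp_sum[symmetric] sum_negf sum_divide_distrib exp_of_real[symmetric])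
  finally show ?thesis .
qed

text \<open>A Gaussian factor is itself an average of characters over an independent Gaussian vector
  \<open>g\<close>; integrating over \<open>\<omega>\<close> first turns the left-hand side into a mixture of characteristic
  functions.\<close>
lemma tendsto_integral_prod_gaussian_of_char:
  fixes Z :: "nat \<Rightarrow> 'w \<Rightarrow> 'b \<Rightarrow> real"
  assumes "prob_space M" and "finite B"
    and Z[measurable]: "\<And>r n. n \<in> B \<Longrightarrow> (\<lambda>\<omega>. Z r \<omega> n) \<in> borel_measurable M"
    and char: "\<And>s :: 'b \<Rightarrow> real. (\<lambda>r. \<integral>\<omega>. iexp (\<Sum>n\<in>B. s n * Z r \<omega> n) \<partial>M)
      \<longlonglongrightarrow> of_real (exp (- (\<Sum>n\<in>B. (s n)\<^sup>2) / 2))"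
  shows "(\<lambda>r. \<integral>\<omega>. (\<Prod>n\<in>B. exp (- (c n * Z r \<omega> n)\<^sup>2 / 2)) \<partial>M)
    \<longlonglongrightarrow> (\<Prod>n\<in>B. \<integral>x. exp (- (c n * x)\<^sup>2 / 2) \<partial>std_normal_distribution)"
proof -
  interpret M: prob_space M by fact
  interpret N: real_distribution std_normal_distribution by (rule real_dist_normal_dist)
  interpret product_prob_space "\<lambda>_ :: 'b. std_normal_distribution" B
    by standard
  define \<Gamma> where "\<Gamma> = (\<Pi>\<^sub>M n\<in>B. std_normal_distribution)"
  interpret \<Gamma>: prob_space \<Gamma> unfolding \<Gamma>_def by (rule prob_space_axioms)
  interpret P: pair_prob_space M \<Gamma> ..
  have [measurable]: "(\<lambda>g. g n) \<in> borel_measurable \<Gamma>" if "n \<in> B" for n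
    unfolding \<Gamma>_def using measurable_component_singleton[OF that, of "\<lambda>_. std_normal_distribution"] by simp
  define \<phi> where "\<phi> r s = (\<integral>\<omega>. iexp (\<Sum>n\<in>B. s n * Z r \<omega> n) \<partial>M)" for r s
  define F where "F r \<omega> g = iexp (\<Sum>n\<in>B. (c n * g n) * Z r \<omega> n)" for r \<omega> g
  have Fm[measurable]: "case_prod (F r) \<in> borel_measurable (M \<Otimes>\<^sub>M \<Gamma>)" for r
    unfolding F_def using \<open>finite B\<close> by measurable
  \<comment> \<open>For fixed \<open>\<omega>\<close> the integral over \<open>g\<close> is a
    Gaussian characteristic function at the point with coordinates
    \<open>c n * Z r \<omega> n\<close>. Fubini applies since characters have modulus 1.\<close>
  have mix: "of_real (\<integral>\<omega>. (\<Prod>n\<in>B. exp (- (c n * Z r \<omega> n)\<^sup>2 / 2)) \<partial>M)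
      = (\<integral>g. \<phi> r (\<lambda>n. c n * g n) \<partial>\<Gamma>)" for r
  proof -
    have "(\<integral>g. F r \<omega> g \<partial>\<Gamma>) = of_real (\<Prod>n\<in>B. exp (- (c n * Z r \<omega> n)\<^sup>2 / 2))" for \<omega>
    proof -
      have "(\<integral>g. F r \<omega> g \<partial>\<Gamma>) = (\<integral>g. iexp (\<Sum>n\<in>B. (c n * Z r \<omega> n) * g n) \<partial>\<Gamma>)"
        unfolding F_def by (simp add: mult_ac)
      also have "\<dots> = of_real (exp (- (\<Sum>n\<in>B. (c n * Z r \<omega> n)\<^sup>2) / 2))"
        unfolding \<Gamma>_def by (rule integral_iexp_std_normal_PiM) fact
      also have "\<dots> = of_real (\<Prod>n\<in>B. exp (- (c n * Z r \<omega> n)\<^sup>2 / 2))"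
        using \<open>finite B\<close> by (simp add: exp_sum[symmetric] sum_negf sum_divide_distrib)
      finally show ?thesis .
    qed
    hence "of_real (\<integral>\<omega>. (\<Prod>n\<in>B. exp (- (c n * Z r \<omega> n)\<^sup>2 / 2)) \<partial>M) = (\<integral>\<omega>. (\<integral>g. F r \<omega> g \<partial>\<Gamma>) \<partial>M)"
      by (simp only: integral_complex_of_real)
    also have "\<dots> = (\<integral>g. (\<integral>\<omega>. F r \<omega> g \<partial>M) \<partial>\<Gamma>)"
      by (rule P.Fubini_integral[symmetric], rule P.P.integrable_const_bound[of _ 1])
        (auto simp: F_def[abs_def] intro!: Fm[unfolded F_def])
    finally show ?thesis by (simp add: F_def \<phi>_def)
  qed
  \<comment> \<open>The integrands are characteristic functions at the random point
    \<open>c n * g n\<close>, hence bounded by 1. Their limit is the original Gaussian function with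
    \<open>g\<close> in place of \<open>Z\<close>, which is why the average over \<open>g\<close> is
    already the claimed limit.\<close>
  have "(\<lambda>r. \<integral>g. \<phi> r (\<lambda>n. c n * g n) \<partial>\<Gamma>) \<longlonglongrightarrow> (\<integral>g. of_real (exp (- (\<Sum>n\<in>B. (c n * g n)\<^sup>2) / 2)) \<partial>\<Gamma>)"
  proof (rule integral_dominated_convergence[where w = "\<lambda>_. 1"])
    show "AE g in \<Gamma>. (\<lambda>r. \<phi> r (\<lambda>n. c n * g n)) \<longlonglongrightarrow> of_real (exp (- (\<Sum>n\<in>B. (c n * g n)\<^sup>2) / 2))"
      unfolding \<phi>_def by (intro AE_I2 char)
    show "AE g in \<Gamma>. norm (\<phi> r (\<lambda>n. c n * g n)) \<le> 1" for r
    proof (rule AE_I2)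
      fix g
      have "norm (\<phi> r (\<lambda>n. c n * g n)) \<le> (\<integral>\<omega>. norm (iexp (\<Sum>n\<in>B. c n * g n * Z r \<omega> n)) \<partial>M)"
        unfolding \<phi>_def by (rule integral_norm_bound)
      thus "norm (\<phi> r (\<lambda>n. c n * g n)) \<le> 1" by (simp add: M.prob_space)
    qed
    show "(\<lambda>g. \<phi> r (\<lambda>n. c n * g n)) \<in> borel_measurable \<Gamma>" for r
    proof -
      have "(\<lambda>g. \<integral>\<omega>. F r \<omega> g \<partial>M) \<in> borel_measurable \<Gamma>"
        by (rule M.borel_measurable_lebesgue_integral) (use Fm in measurable)
      thus ?thesis by (simp add: F_def \<phi>_def)
    qed
  qed (use \<open>finite B\<close> in measurable)
  also have "(\<integral>g. of_real (exp (- (\<Sum>n\<in>B. (c n * g n)\<^sup>2) / 2)) \<partial>\<Gamma>)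
      = complex_of_real (\<integral>g. (\<Prod>n\<in>B. exp (- (c n * g n)\<^sup>2 / 2)) \<partial>\<Gamma>)"
    using \<open>finite B\<close> by (simp add: exp_sum[symmetric] sum_negf sum_divide_distrib)
  also have "(\<integral>g. (\<Prod>n\<in>B. exp (- (c n * g n)\<^sup>2 / 2)) \<partial>\<Gamma>)
      = (\<Prod>n\<in>B. \<integral>x. exp (- (c n * x)\<^sup>2 / 2) \<partial>std_normal_distribution)"
    unfolding \<Gamma>_def using \<open>finite B\<close>
  proof (rule product_integral_prod)
    show "integrable std_normal_distribution (\<lambda>x. exp (- (c n * x)\<^sup>2 / 2))" for n
      by (rule N.integrable_const_bound[of _ 1]) auto
  qed
  finally show ?thesis unfolding mix[symmetric] by (simp only: tendsto_of_real_iff)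
qed

text \<open>The Cramer--Wold device: along each direction \<open>s\<close> the claim is the one-dimensional central
  limit theorem.\<close>
lemma (in prob_space) multivariate_clt_char:
  fixes Y :: "nat \<Rightarrow> 'a \<Rightarrow> 'x" and q :: "'b \<Rightarrow> 'x \<Rightarrow> real"
  assumes indep: "indep_vars (\<lambda>_. count_space S) Y UNIV"
    and dist: "\<And>k. distr M (count_space S) (Y k) = \<mu>"
    and "finite S" and "finite B"
    and mean: "\<And>n. n \<in> B \<Longrightarrow> (\<integral>x. q n x \<partial>\<mu>) = 0"
    and cov: "\<And>n n'. n \<in> B \<Longrightarrow> n' \<in> B \<Longrightarrow> (\<integral>x. q n x * q n' x \<partial>\<mu>) = of_bool (n = n')"
  shows "(\<lambda>r. \<integral>\<omega>. iexp (\<Sum>n\<in>B. s n * ((\<Sum>k<r. q n (Y k \<omega>)) / sqrt r)) \<partial>M)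
    \<longlonglongrightarrow> of_real (exp (- (\<Sum>n\<in>B. (s n)\<^sup>2) / 2))"
proof -
  have Y[measurable]: "Y k \<in> measurable M (count_space S)" for k
    using indep by (auto simp: indep_vars_def)
  have q[measurable]: "f \<in> borel_measurable (count_space S)" for f :: "'x \<Rightarrow> real" by simp
  define V where "V = (\<lambda>x. \<Sum>n\<in>B. s n * q n x)"
  have \<mu>: "prob_space \<mu>" "sets \<mu> = sets (count_space S)"
    using prob_space_distr[OF Y] by (simp_all add: dist[of 0, symmetric])
  interpret \<mu>: prob_space \<mu> by fact
  have fin: "finite (space \<mu>)" using \<mu>(2) \<open>finite S\<close> by (simp add: sets_eq_imp_space_eq[OF \<mu>(2)])
  \<comment> \<open>On a finite space every real function is bounded, which settles all
    integrability questions below.\<close>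
  have int: "integrable \<mu> f" for f :: "'x \<Rightarrow> real"
  proof (rule \<mu>.integrable_const_bound)
    show "AE x in \<mu>. norm (f x) \<le> Max ((\<lambda>x. \<bar>f x\<bar>) ` space \<mu>)"
      using fin by (auto intro!: AE_I2 Max_ge)
    show "f \<in> borel_measurable \<mu>" using q measurable_cong_sets[OF \<mu>(2) refl] by blast
  qed
  have V0: "(\<integral>x. V x \<partial>\<mu>) = 0"
    unfolding V_def using int mean by (subst Bochner_Integration.integral_sum) auto
  have V2: "(\<integral>x. (V x)\<^sup>2 \<partial>\<mu>) = (\<Sum>n\<in>B. (s n)\<^sup>2)"
  proof -
    have "(\<integral>x. (V x)\<^sup>2 \<partial>\<mu>) = (\<integral>x. (\<Sum>n\<in>B. \<Sum>n'\<in>B. (s n * s n') * (q n x * q n' x)) \<partial>\<mu>)"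
      unfolding V_def power2_eq_square by (simp add: sum_product mult_ac)
    also have "\<dots> = (\<Sum>n\<in>B. \<Sum>n'\<in>B. (s n * s n') * of_bool (n = n'))"
      using int cov by (simp add: Bochner_Integration.integral_sum)
    also have "\<dots> = (\<Sum>n\<in>B. (s n)\<^sup>2)"
      using \<open>finite B\<close> by (simp add: of_bool_def if_distrib power2_eq_square cong: if_cong)
    finally show ?thesis .
  qed
  define \<sigma> where "\<sigma> = sqrt (\<Sum>n\<in>B. (s n)\<^sup>2)"
  have \<sigma>2: "\<sigma>\<^sup>2 = (\<Sum>n\<in>B. (s n)\<^sup>2)" by (simp add: \<sigma>_def sum_nonneg)
  have lhs: "(\<Sum>n\<in>B. s n * ((\<Sum>k<r. q n (Y k \<omega>)) / sqrt r)) = (\<Sum>k<r. V (Y k \<omega>)) / sqrt r" for r \<omega>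
    unfolding V_def by (subst sum.swap) (simp add: sum_divide_distrib sum_distrib_left)
  show ?thesis
  proof (cases "\<sigma> = 0")
    \<comment> \<open>The central limit theorem needs positive variance. In the degenerate direction
      all \<open>s n\<close> with \<open>n \<in> B\<close> vanish, and both sides equal 1.\<close>
    case True
    then have "\<And>n. n \<in> B \<Longrightarrow> s n = 0"
      using \<sigma>2 \<open>finite B\<close> by (simp add: sum_nonneg_eq_0_iff)
    thus ?thesis by (simp add: prob_space)
  next
    case False
    then have "\<sigma> > 0" by (simp add: \<sigma>_def less_le sum_nonneg)
    have E: "expectation (\<lambda>\<omega>. f (Y k \<omega>)) = (\<integral>x. f x \<partial>\<mu>)" for f :: "'x \<Rightarrow> real" and k
      unfolding dist[of k, symmetric] by (rule integral_distr[symmetric]) auto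
    have I: "integrable M (\<lambda>\<omega>. f (Y k \<omega>))" for f :: "'x \<Rightarrow> real" and k
      using int[of f] unfolding dist[of k, symmetric] by (subst (asm) integrable_distr_eq) auto
    have "weak_conv_m (\<lambda>r. distr M borel (\<lambda>\<omega>. (\<Sum>k<r. V (Y k \<omega>)) / sqrt (r * \<sigma>\<^sup>2))) std_normal_distribution"
    proof (rule central_limit_theorem_zero_mean[where \<mu> = "distr \<mu> borel V"])
      show "indep_vars (\<lambda>_. borel) (\<lambda>k \<omega>. V (Y k \<omega>)) UNIV"
        by (rule indep_vars_compose2[OF indep]) simp
      show "expectation (\<lambda>\<omega>. V (Y k \<omega>)) = 0" for k using V0 by (simp add: E)
      then show "variance (\<lambda>\<omega>. V (Y k \<omega>)) = \<sigma>\<^sup>2" for k using V2 E[of "\<lambda>x. (V x)\<^sup>2"] by (simp add: \<sigma>2)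
      show "integrable M (\<lambda>\<omega>. (V (Y k \<omega>))\<^sup>2)" for k by (rule I)
      show "distr M borel (\<lambda>\<omega>. V (Y k \<omega>)) = distr \<mu> borel V" for k
        unfolding dist[of k, symmetric] by (subst distr_distr) (auto simp: o_def)
    qed fact
    \<comment> \<open>The theorem normalises by \<open>sqrt (r * \<sigma>\<^sup>2)\<close>.
      Evaluating the characteristic function at \<open>\<sigma>\<close> rather than at 1 cancels the
      extra factor and produces the exponent \<open>- \<sigma>\<^sup>2 / 2\<close>.\<close>
    hence "(\<lambda>r. char (distr M borel (\<lambda>\<omega>. (\<Sum>k<r. V (Y k \<omega>)) / sqrt (r * \<sigma>\<^sup>2))) \<sigma>)
        \<longlonglongrightarrow> char std_normal_distribution \<sigma>"
      by (intro levy_continuity1 real_dist_normal_dist real_distribution_distr) simp_all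
    moreover have "char (distr M borel (\<lambda>\<omega>. (\<Sum>k<r. V (Y k \<omega>)) / sqrt (r * \<sigma>\<^sup>2))) \<sigma>
        = (\<integral>\<omega>. iexp ((\<Sum>k<r. V (Y k \<omega>)) / sqrt r) \<partial>M)" for r
      unfolding char_def using \<open>\<sigma> > 0\<close> by (subst integral_distr) (auto simp: real_sqrt_mult)
    ultimately show ?thesis
      unfolding lhs by (simp add: char_std_normal_distribution \<sigma>2)
  qed
qed

subsection \<open>Words and their types\<close>

lemma sum_rotate:
  "(\<Sum>x\<in>A. \<Sum>y\<in>B. \<Sum>z\<in>C. f x y z) = (\<Sum>y\<in>B. \<Sum>z\<in>C. \<Sum>x\<in>A. f x y z)"
  by (rule trans[OF sum.swap sum.cong[OF refl sum.swap]])

abbreviation words :: "nat \<Rightarrow> nat set \<Rightarrow> (nat \<Rightarrow> nat) set" where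
  "words N S \<equiv> {..<N} \<rightarrow>\<^sub>E S"

text \<open>The letter 0 stands for the constant term 1 of a linear factor and leaves no trace in
  the type. One notion of type thus serves both kinds of words: those over \<open>{1..d}\<close>,
  where 0 does not occur, and those over \<open>{..<d}\<close>, where 0 pads the length up to
  \<open>N\<close>.\<close>

definition letter :: "nat \<Rightarrow> (nat \<Rightarrow>\<^sub>0 nat)" where
  "letter l = (if l = 0 then 0 else Poly_Mapping.single l 1)"

definition word_type :: "nat \<Rightarrow> (nat \<Rightarrow> nat) \<Rightarrow> (nat \<Rightarrow>\<^sub>0 nat)" where
  "word_type N b = (\<Sum>k<N. letter (b k))"

definition typed_words :: "nat \<Rightarrow> nat set \<Rightarrow> (nat \<Rightarrow>\<^sub>0 nat) \<Rightarrow> (nat \<Rightarrow> nat) set" where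
  "typed_words N S n = {b \<in> words N S. word_type N b = n}"

lemma finite_words [simp, intro]: "finite S \<Longrightarrow> finite (words N S)"
  by (rule finite_PiE) auto

lemma finite_typed_words [simp, intro]: "finite S \<Longrightarrow> finite (typed_words N S n)"
  by (simp add: typed_words_def)

lemma lookup_word_type:
  "Poly_Mapping.lookup (word_type N b) l = (if l = 0 then 0 else card {k. k < N \<and> b k = l})"
proof -
  have "Poly_Mapping.lookup (word_type N b) l = (\<Sum>k<N. of_bool (b k = l \<and> l \<noteq> 0))"
    unfolding word_type_def lookup_sum
    by (intro sum.cong refl) (auto simp: letter_def lookup_single when_def)
  also have "\<dots> = (if l = 0 then 0 else card {k. k < N \<and> b k = l})"
    by (auto simp: of_bool_def sum.If_cases intro!: arg_cong[where f = card])
  finally show ?thesis .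
qed

lemma sum_card_fibres:
  assumes "finite S" "b \<in> words N S"
  shows "(\<Sum>s\<in>S. card {k. k < N \<and> b k = s}) = N"
proof -
  have "(\<Sum>s\<in>S. card {k. k < N \<and> b k = s}) = (\<Sum>s\<in>S. \<Sum>k\<in>{k\<in>{..<N}. b k = s}. 1)"
    by (auto intro!: sum.cong arg_cong[where f = card])
  also have "\<dots> = (\<Sum>k<N. 1)"
    by (rule sum.group) (use assms in \<open>auto simp: PiE_iff\<close>)
  finally show ?thesis by simp
qed

text \<open>Listing the values of a word identifies these words with the arrangements of the
  multiset that has \<open>c s\<close> copies of each \<open>s\<close>.\<close>

lemma card_words_with_fibres:
  assumes "finite S" "(\<Sum>s\<in>S. c s) = N"
  shows "real (card {b \<in> words N S. \<forall>s\<in>S. card {k. k < N \<and> b k = s} = c s})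
    = fact N / (\<Prod>s\<in>S. fact (c s))"
proof -
  define A where "A = (\<Sum>s\<in>S. replicate_mset (c s) s)"
  have count_A: "count A s = (if s \<in> S then c s else 0)" for s
    using \<open>finite S\<close> by (simp add: A_def count_sum count_replicate_mset)
  have "size (\<Sum>s\<in>T. replicate_mset (c s) s) = (\<Sum>s\<in>T. c s)" if "finite T" for T
    using that by (induction T rule: finite_induct) auto
  hence size_A: "size A = N" using assms by (simp add: A_def)
  have set_A: "set_mset A \<subseteq> S" by (auto simp: count_A simp flip: count_greater_zero_iff split: if_splits)
  have count_map: "count (mset (map b [0..<N])) s = card {k. k < N \<and> b k = s}" for b :: "nat \<Rightarrow> 'a" and s
  proof -
    have "count (mset (map b [0..<N])) s = length (filter (\<lambda>k. b k = s) [0..<N])"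
      by (induction N) auto
    thus ?thesis by (simp add: length_filter_conv_card conj_commute cong: conj_cong)
  qed
  have "bij_betw (\<lambda>b. map b [0..<N]) {b \<in> words N S. \<forall>s\<in>S. card {k. k < N \<and> b k = s} = c s}
      (permutations_of_multiset A)"
  proof (rule bij_betw_byWitness[where f' = "\<lambda>xs. \<lambda>k\<in>{..<N}. xs ! k"])
    show "\<forall>b\<in>{b \<in> words N S. \<forall>s\<in>S. card {k. k < N \<and> b k = s} = c s}.
        (\<lambda>k\<in>{..<N}. map b [0..<N] ! k) = b"
      by (auto simp: fun_eq_iff PiE_iff extensional_def restrict_def)
    show "\<forall>xs\<in>permutations_of_multiset A. map (\<lambda>k\<in>{..<N}. xs ! k) [0..<N] = xs"
    proof
      fix xs assume "xs \<in> permutations_of_multiset A"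
      hence "length xs = N"
        using size_A by (metis permutations_of_multisetD size_mset)
      thus "map (\<lambda>k\<in>{..<N}. xs ! k) [0..<N] = xs" by (auto intro: nth_equalityI)
    qed
    show "(\<lambda>b. map b [0..<N]) ` {b \<in> words N S. \<forall>s\<in>S. card {k. k < N \<and> b k = s} = c s}
        \<subseteq> permutations_of_multiset A"
    proof (clarify, rule permutations_of_multisetI, rule multiset_eqI)
      fix b s assume b: "b \<in> words N S" "\<forall>s\<in>S. card {k. k < N \<and> b k = s} = c s"
      have "s \<notin> S \<Longrightarrow> {k. k < N \<and> b k = s} = {}" using b(1) by (auto simp: PiE_iff)
      thus "count (mset (map b [0..<N])) s = count A s"
        unfolding count_map count_A using b(2) by auto
    qed
    show "(\<lambda>xs. \<lambda>k\<in>{..<N}. xs ! k) ` permutations_of_multiset A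
        \<subseteq> {b \<in> words N S. \<forall>s\<in>S. card {k. k < N \<and> b k = s} = c s}"
    proof clarify
      fix xs assume "xs \<in> permutations_of_multiset A"
      then have xs: "mset xs = A" by (rule permutations_of_multisetD)
      then have len: "length xs = N" using size_A by (metis size_mset)
      have "xs ! k \<in> S" if "k < N" for k
        using that set_A len xs by (metis nth_mem set_mset_mset subsetD)
      moreover have "card {k. k < N \<and> (\<lambda>k\<in>{..<N}. xs ! k) k = s} = c s" if "s \<in> S" for s
      proof -
        have "map (\<lambda>k\<in>{..<N}. xs ! k) [0..<N] = xs" using len by (auto intro: nth_equalityI)
        thus ?thesis using count_map[of "\<lambda>k\<in>{..<N}. xs ! k" s] that by (simp add: xs count_A)
      qed
      ultimately show "(\<lambda>k\<in>{..<N}. xs ! k) \<in> words N S \<and>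
          (\<forall>s\<in>S. card {k. k < N \<and> (\<lambda>k\<in>{..<N}. xs ! k) k = s} = c s)" by auto
    qed
  qed
  hence "card {b \<in> words N S. \<forall>s\<in>S. card {k. k < N \<and> b k = s} = c s} = card (permutations_of_multiset A)"
    by (rule bij_betw_same_card)
  also have "real \<dots> = fact N / (\<Prod>x\<in>set_mset A. fact (count A x))"
    using card_permutations_of_multiset[of A] by (simp add: size_A real_of_nat_div)
  also have "(\<Prod>x\<in>set_mset A. fact (count A x)) = (\<Prod>s\<in>S. fact (c s) :: real)"
    using \<open>finite S\<close> set_A by (intro prod.mono_neutral_cong_left) (auto simp: count_A not_in_iff)
  finally show ?thesis .
qed

lemma keys_word_type: "b \<in> words N S \<Longrightarrow> Poly_Mapping.keys (word_type N b) \<subseteq> S - {0}"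
  by (auto simp: in_keys_iff lookup_word_type PiE_iff card_gt_0_iff split: if_splits)

lemma word_type_in_weak_comps:
  assumes "a \<in> words N {1..d}"
  shows "word_type N a \<in> weak_comps d N"
proof -
  have "(\<Sum>j=1..d. Poly_Mapping.lookup (word_type N a) j) = (\<Sum>j=1..d. card {k. k < N \<and> a k = j})"
    by (intro sum.cong) (auto simp: lookup_word_type)
  moreover have "Poly_Mapping.keys (word_type N a) \<subseteq> {1..d}"
    using keys_word_type[OF assms] by auto
  ultimately show ?thesis
    using sum_card_fibres[OF _ assms] by (simp add: weak_comps_def)
qed

text \<open>Each nonzero letter contributes one to the total degree and the padding letter 0
  contributes nothing. This lets degrees of multi-indices be read off as numbers of nonzero
  letters.\<close>

lemma word_type_degree:
  assumes "b \<in> words N {..<d}"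
  shows "word_type N b \<in> weak_comps (d - 1) (card {k. k < N \<and> b k \<noteq> 0})"
proof -
  have "(\<Sum>l\<in>{1..d-1}. card {k. k < N \<and> b k = l}) = (\<Sum>l\<in>{1..d-1}. \<Sum>k\<in>{k\<in>{k. k < N \<and> b k \<noteq> 0}. b k = l}. 1)"
    by (auto intro!: sum.cong arg_cong[where f = card])
  also have "\<dots> = (\<Sum>k\<in>{k. k < N \<and> b k \<noteq> 0}. 1)"
    by (rule sum.group) (use assms in \<open>force simp: PiE_iff\<close>)+
  moreover have "{..<d} - {0} \<subseteq> {1..d-1}" by auto
  ultimately show ?thesis using keys_word_type[OF assms]
    by (auto simp: weak_comps_def lookup_word_type cong: sum.cong_simp)
qed

lemma weak_comps_eqI:
  assumes "x \<in> weak_comps m i" "y \<in> weak_comps m i'"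
    and "\<And>j. j \<in> {1..m} \<Longrightarrow> Poly_Mapping.lookup x j = Poly_Mapping.lookup y j"
  shows "x = y"
proof (rule poly_mapping_eqI)
  fix j show "Poly_Mapping.lookup x j = Poly_Mapping.lookup y j"
  proof (cases "j \<in> {1..m}")
    case False
    hence "j \<notin> Poly_Mapping.keys x" "j \<notin> Poly_Mapping.keys y"
      using assms(1,2) by (auto simp: weak_comps_def)
    thus ?thesis by (simp add: in_keys_iff)
  qed (rule assms(3))
qed

lemma card_typed_words_points:
  assumes "x \<in> weak_comps d N"
  shows "real (card (typed_words N {1..d} x)) = fact N / (\<Prod>j=1..d. fact (Poly_Mapping.lookup x j))"
proof -
  have "word_type N a = x \<longleftrightarrow> (\<forall>j\<in>{1..d}. card {k. k < N \<and> a k = j} = Poly_Mapping.lookup x j)"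
    if a: "a \<in> words N {1..d}" for a
  proof
    assume "word_type N a = x"
    hence "Poly_Mapping.lookup x = (\<lambda>j. if j = 0 then 0 else card {k. k < N \<and> a k = j})"
      by (simp add: fun_eq_iff flip: lookup_word_type)
    thus "\<forall>j\<in>{1..d}. card {k. k < N \<and> a k = j} = Poly_Mapping.lookup x j" by simp
  next
    assume "\<forall>j\<in>{1..d}. card {k. k < N \<and> a k = j} = Poly_Mapping.lookup x j"
    thus "word_type N a = x"
      by (intro weak_comps_eqI[OF word_type_in_weak_comps[OF a] assms]) (simp add: lookup_word_type)
  qed
  hence "typed_words N {1..d} x
      = {a \<in> words N {1..d}. \<forall>j\<in>{1..d}. card {k. k < N \<and> a k = j} = Poly_Mapping.lookup x j}"
    unfolding typed_words_def by blast
  moreover have "(\<Sum>j=1..d. Poly_Mapping.lookup x j) = N" using assms by (simp add: weak_comps_def)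
  ultimately show ?thesis
    using card_words_with_fibres[of "{1..d}" "Poly_Mapping.lookup x" N] by (simp only: finite_atLeastAtMost)
qed

text \<open>This identifies the normalising constant of the Krawtchouk polynomials with the number
  of words in the expansion. The type fixes the counts of the nonzero letters, and the length
  \<open>N\<close> then fixes the count of 0.\<close>

lemma card_typed_words_indices:
  assumes "n \<in> weak_comps (d - 1) i" "i \<le> N" "1 \<le> d"
  shows "real (card (typed_words N {..<d} n)) = index_coeff d N n"
proof -
  have d: "{..<d} = insert 0 {1..d - 1}" using \<open>1 \<le> d\<close> by auto
  \<comment> \<open>The value at 0 is the factor \<open>N - |n|\<close> of the multinomial
    coefficient: the positions left for padding.\<close>
  define c where "c l = (if l = 0 then N - i else Poly_Mapping.lookup n l)" for l
  have i: "(\<Sum>l=1..d-1. Poly_Mapping.lookup n l) = i" using assms(1) by (simp add: weak_comps_def)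
  have eq: "(\<Sum>l=1..d-1. c l) = i" unfolding i[symmetric] by (intro sum.cong) (auto simp: c_def)
  have c: "(\<Sum>l<d. c l) = N"
    unfolding d using \<open>i \<le> N\<close> eq by (simp add: c_def[of 0])
  have "word_type N b = n \<longleftrightarrow> (\<forall>l<d. card {k. k < N \<and> b k = l} = c l)" if b: "b \<in> words N {..<d}" for b
  proof
    assume n: "word_type N b = n"
    then have pos: "card {k. k < N \<and> b k = l} = c l" if "l \<noteq> 0" for l
      using that by (auto simp: c_def lookup_word_type)
    have "card {k. k < N \<and> b k = 0} + (\<Sum>l=1..d-1. c l) = N"
      using sum_card_fibres[OF _ b] pos unfolding d by simp
    hence "card {k. k < N \<and> b k = 0} = c 0" using eq by (simp add: c_def[of 0])
    with pos show "\<forall>l<d. card {k. k < N \<and> b k = l} = c l" by metis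
  next
    assume "\<forall>l<d. card {k. k < N \<and> b k = l} = c l"
    thus "word_type N b = n"
      by (intro weak_comps_eqI[OF word_type_degree[OF b] assms(1)]) (auto simp: lookup_word_type c_def)
  qed
  hence "typed_words N {..<d} n = {b \<in> words N {..<d}. \<forall>l\<in>{..<d}. card {k. k < N \<and> b k = l} = c l}"
    by (auto simp: typed_words_def)
  hence "real (card (typed_words N {..<d} n)) = fact N / (\<Prod>l<d. fact (c l))"
    using card_words_with_fibres[of "{..<d}" c N] c by simp
  also have "(\<Prod>l<d. fact (c l)) = fact (N - i) * (\<Prod>l=1..d-1. fact (Poly_Mapping.lookup n l) :: real)"
    unfolding d by (simp add: c_def)
  finally show ?thesis unfolding index_coeff_def i by (simp add: mult.commute)
qed

text \<open>Surjectivity comes from counting: the number of words of a given type is a positive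
  quotient, so there is at least one. Finiteness of the configuration space follows.\<close>

lemma weak_comps_eq_image: "weak_comps d N = word_type N ` words N {1..d}"
proof (intro equalityI subsetI)
  fix x assume "x \<in> weak_comps d N"
  from card_typed_words_points[OF this] have "real (card (typed_words N {1..d} x)) > 0"
    by (simp add: prod_pos)
  hence "typed_words N {1..d} x \<noteq> {}" by auto
  thus "x \<in> word_type N ` words N {1..d}" by (auto simp: typed_words_def)
qed (use word_type_in_weak_comps in auto)

lemma finite_weak_comps [simp, intro]: "finite (weak_comps d N)"
  by (simp add: weak_comps_eq_image)

lemma weak_comps_0: "weak_comps m 0 = {0}"
proof (intro equalityI subsetI)
  have z: "0 \<in> weak_comps m 0" by (simp add: weak_comps_def)
  fix n assume n: "n \<in> weak_comps m 0"
  have "n = 0"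
    by (rule weak_comps_eqI[OF n z]) (use n in \<open>simp add: weak_comps_def\<close>)
  thus "n \<in> {0}" by simp
qed (simp add: weak_comps_def)

lemma weak_comps_1: "weak_comps m 1 = (\<lambda>l. Poly_Mapping.single l 1) ` {1..m}"
proof -
  have s: "Poly_Mapping.single l 1 \<in> weak_comps m 1" if "l \<in> {1..m}" for l
    using that by (simp add: weak_comps_def lookup_single when_def)
  show ?thesis
  proof (intro equalityI subsetI)
    fix n assume n: "n \<in> weak_comps m 1"
    hence "\<exists>l\<in>{1..m}. Poly_Mapping.lookup n l = 1 \<and> (\<forall>j\<in>{1..m}. l \<noteq> j \<longrightarrow> Poly_Mapping.lookup n j = 0)"
      using sum_eq_1_iff[of "{1..m}" "Poly_Mapping.lookup n"] by (simp add: weak_comps_def)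
    then obtain l where l: "l \<in> {1..m}" "Poly_Mapping.lookup n l = 1"
        "\<And>j. j \<in> {1..m} \<Longrightarrow> l \<noteq> j \<Longrightarrow> Poly_Mapping.lookup n j = 0"
      by metis
    have "n = Poly_Mapping.single l 1"
    proof (rule weak_comps_eqI[OF n s[OF l(1)]])
      fix j assume "j \<in> {1..m}"
      thus "Poly_Mapping.lookup n j = Poly_Mapping.lookup (Poly_Mapping.single l 1) j"
        using l(2) l(3)[of j] by (cases "l = j") (simp_all add: lookup_single when_def)
    qed
    thus "n \<in> (\<lambda>l. Poly_Mapping.single l 1) ` {1..m}" using l(1) by blast
  next
    fix n assume "n \<in> (\<lambda>l. Poly_Mapping.single l (1::nat)) ` {1..m}"
    thus "n \<in> weak_comps m 1" using s by blast
  qed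
qed

text \<open>Stars and bars. With \<open>m = d - 1\<close> this is the number of degrees of freedom
  in the limit law.\<close>

lemma card_weak_comps:
  assumes "1 \<le> m"
  shows "card (weak_comps m i) = (i + m - 1) choose (m - 1)"
proof -
  \<comment> \<open>List positions start at 0 while supports lie in \<open>{1..m}\<close>, hence the
    shift by \<open>Suc\<close>.\<close>
  have "bij_betw (\<lambda>x. map (\<lambda>j. Poly_Mapping.lookup x (Suc j)) [0..<m]) (weak_comps m i)
      {l :: nat list. length l = m \<and> sum_list l = i}"
  proof (rule bij_betw_byWitness[where f' = "\<lambda>l. \<Sum>j<m. Poly_Mapping.single (Suc j) (l ! j)"])
    have lk: "Poly_Mapping.lookup (\<Sum>j<m. Poly_Mapping.single (Suc j) (l ! j)) j
        = (if j \<in> {1..m} then l ! (j - 1) else 0)" for l :: "nat list" and j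
    proof -
      have "Poly_Mapping.lookup (\<Sum>j<m. Poly_Mapping.single (Suc j) (l ! j)) j
          = (\<Sum>j'<m. if j' = j - 1 \<and> j \<noteq> 0 then l ! j' else 0)"
        unfolding lookup_sum by (intro sum.cong) (auto simp: lookup_single when_def)
      thus ?thesis by (cases j) (auto simp: sum.delta)
    qed
    have sl: "sum_list l = (\<Sum>j<length l. l ! j)" for l :: "nat list"
      by (simp add: sum_list_sum_nth atLeast0LessThan)
    show "\<forall>x\<in>weak_comps m i. (\<Sum>j<m. Poly_Mapping.single (Suc j)
        (map (\<lambda>j. Poly_Mapping.lookup x (Suc j)) [0..<m] ! j)) = x"
    proof
      fix x assume x: "x \<in> weak_comps m i"
      show "(\<Sum>j<m. Poly_Mapping.single (Suc j) (map (\<lambda>j. Poly_Mapping.lookup x (Suc j)) [0..<m] ! j)) = x"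
        by (rule poly_mapping_eqI, unfold lk) (use x in \<open>auto simp: weak_comps_def in_keys_iff subset_iff\<close>)
    qed
    show "\<forall>l\<in>{l. length l = m \<and> sum_list l = i}. map (\<lambda>j. Poly_Mapping.lookup
        (\<Sum>j<m. Poly_Mapping.single (Suc j) (l ! j)) (Suc j)) [0..<m] = l"
      by (auto simp: lk intro!: nth_equalityI)
    show "(\<lambda>x. map (\<lambda>j. Poly_Mapping.lookup x (Suc j)) [0..<m]) ` weak_comps m i
        \<subseteq> {l. length l = m \<and> sum_list l = i}"
      by (auto simp: weak_comps_def sum.atLeast1_atMost_eq sl)
    show "(\<lambda>l. \<Sum>j<m. Poly_Mapping.single (Suc j) (l ! j)) ` {l. length l = m \<and> sum_list l = i} \<subseteq> weak_comps m i"
    proof (rule image_subsetI)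
      fix l :: "nat list" assume l: "l \<in> {l. length l = m \<and> sum_list l = i}"
      have "(\<Sum>j=1..m. Poly_Mapping.lookup (\<Sum>j<m. Poly_Mapping.single (Suc j) (l ! j)) j) = i"
      proof -
        have "(\<Sum>j=1..m. if j \<in> {1..m} then l ! (j - 1) else 0) = (\<Sum>j=1..m. l ! (j - 1))"
          by (intro sum.cong) auto
        also have "\<dots> = (\<Sum>j<m. l ! j)" by (simp add: sum.atLeast1_atMost_eq)
        also have "\<dots> = i" using l sl[of l] by auto
        finally show ?thesis unfolding lk .
      qed
      moreover have "Poly_Mapping.keys (\<Sum>j<m. Poly_Mapping.single (Suc j) (l ! j)) \<subseteq> {1..m}"
        unfolding subset_iff in_keys_iff lk by auto
      ultimately show "(\<Sum>j<m. Poly_Mapping.single (Suc j) (l ! j)) \<in> weak_comps m i"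
        unfolding weak_comps_def by (intro CollectI conjI)
    qed
  qed
  hence "card (weak_comps m i) = card {l :: nat list. length l = m \<and> sum_list l = i}"
    by (rule bij_betw_same_card)
  also have "\<dots> = (i + m - 1) choose i" by (rule card_length_sum_list)
  also have "\<dots> = (i + m - 1) choose (m - 1)"
    using assms by (subst binomial_symmetric) auto
  finally show ?thesis .
qed

text \<open>Distributing the product chooses one letter per position, and multiplying monomials adds
  the letters up to the type. It is used in both directions: for a fixed configuration word to
  expand over index words, and for a fixed index word to expand over configuration words.\<close>

lemma lookup_prod_sum_letters:
  fixes F :: "nat \<Rightarrow> nat \<Rightarrow> real"
  assumes "finite S"
  shows "Poly_Mapping.lookup (\<Prod>k<N. \<Sum>l\<in>S. Poly_Mapping.single (letter l) (F k l)) n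
    = (\<Sum>b\<in>typed_words N S n. \<Prod>k<N. F k (b k))"
proof -
  have single: "(\<Prod>k\<in>K. Poly_Mapping.single (letter (b k)) (F k (b k)))
      = Poly_Mapping.single (\<Sum>k\<in>K. letter (b k)) (\<Prod>k\<in>K. F k (b k))" if "finite K" for K b
    using that by (induction K rule: finite_induct) (auto simp: mult_single)
  have "(\<Prod>k<N. \<Sum>l\<in>S. Poly_Mapping.single (letter l) (F k l))
      = (\<Sum>b\<in>words N S. Poly_Mapping.single (word_type N b) (\<Prod>k<N. F k (b k)))"
    using assms by (subst prod_sum_PiE) (auto simp: single word_type_def)
  hence "Poly_Mapping.lookup (\<Prod>k<N. \<Sum>l\<in>S. Poly_Mapping.single (letter l) (F k l)) n
      = (\<Sum>b\<in>words N S. if word_type N b = n then \<Prod>k<N. F k (b k) else 0)"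
    by (simp add: lookup_sum lookup_single when_def)
  also have "\<dots> = (\<Sum>b\<in>typed_words N S n. \<Prod>k<N. F k (b k))"
    using assms by (simp add: sum.inter_filter typed_words_def)
  finally show ?thesis .
qed

lemma prod_eq_prod_power_fibres:
  fixes f :: "nat \<Rightarrow> 'a :: comm_semiring_1"
  assumes "finite S" "b \<in> words N S"
  shows "(\<Prod>k<N. f (b k)) = (\<Prod>s\<in>S. f s ^ card {k. k < N \<and> b k = s})"
proof -
  have "(\<Prod>k<N. f (b k)) = (\<Prod>s\<in>S. \<Prod>k\<in>{k\<in>{..<N}. b k = s}. f (b k))"
    by (rule prod.group[symmetric]) (use assms in \<open>auto simp: PiE_iff\<close>)
  thus ?thesis by (auto intro!: prod.cong)
qed

subsection \<open>Krawtchouk polynomials and their kernels\<close>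

lemma sum_emp:
  assumes "finite S" "\<And>k. k \<in> {1..r} \<Longrightarrow> X k \<in> S"
  shows "(\<Sum>x\<in>S. f x * emp r X x) = (\<Sum>k=1..r. f (X k)) / real r"
proof -
  have "(\<Sum>k=1..r. f (X k)) = (\<Sum>x\<in>S. \<Sum>k\<in>{k\<in>{1..r}. X k = x}. f (X k))"
    by (rule sum.group[symmetric]) (use assms in auto)
  also have "\<dots> = (\<Sum>x\<in>S. f x * real (sample_count r X x))"
    by (intro sum.cong refl) (simp add: sample_count_def mult.commute)
  finally show ?thesis by (simp add: emp_def sum_divide_distrib)
qed

locale krawtchouk_basis =
  fixes d N :: nat and p :: "nat \<Rightarrow> real" and u :: "nat \<Rightarrow> nat \<Rightarrow> real"
  assumes d_pos: "1 \<le> d"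
    and p_pos: "\<And>j. j \<in> {1..d} \<Longrightarrow> 0 < p j"
    and p_sum: "(\<Sum>j=1..d. p j) = 1"
    and basis: "orthonormal_basis d p u"
begin

lemma letters: "{..<d} = insert 0 {1..d - 1}"
  using d_pos by auto

lemma u_0: "j \<in> {1..d} \<Longrightarrow> u 0 j = 1"
  using basis by (simp add: orthonormal_basis_def)

lemma orthonormal: "k < d \<Longrightarrow> l < d \<Longrightarrow> (\<Sum>j=1..d. u k j * u l j * p j) = of_bool (k = l)"
  using basis d_pos by (auto simp: orthonormal_basis_def)

text \<open>The weighted sum of squares of the defects of the dual relation is
  \<open>d - 2 d + d = 0\<close> by orthonormality, so every defect vanishes.\<close>
lemma dual_orthonormal:
  assumes "j \<in> {1..d}" "j' \<in> {1..d}"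
  shows "(\<Sum>l<d. u l j * u l j') = of_bool (j = j') / p j"
proof -
  define S where "S j j' = (\<Sum>l<d. u l j * u l j')" for j j'
  define \<Delta> where "\<Delta> j j' = of_bool (j = j') / p j - S j j'" for j j'
  have "(\<Sum>j=1..d. \<Sum>j'=1..d. p j * p j' * (\<Delta> j j')\<^sup>2)
      = (\<Sum>j=1..d. \<Sum>j'=1..d. of_bool (j = j') * (1 - 2 * p j * S j j) + p j * p j' * (S j j')\<^sup>2)"
    using p_pos less_imp_neq[OF p_pos]
    by (intro sum.cong refl) (auto simp: \<Delta>_def power2_eq_square field_simps)
  also have "\<dots> = (\<Sum>j=1..d. 1 - 2 * p j * S j j) + (\<Sum>j=1..d. \<Sum>j'=1..d. p j * p j' * (S j j')\<^sup>2)"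
  proof -
    have "(\<Sum>j'=1..d. of_bool (j = j') * c) = c" if "j \<in> {1..d}" for j :: nat and c :: real
      using that by (simp add: of_bool_def if_distrib[of "\<lambda>x. x * c"] cong: if_cong)
    thus ?thesis unfolding sum.distrib by (intro arg_cong2[where f = "(+)"] sum.cong refl) blast
  qed
  also have "(\<Sum>j=1..d. 1 - 2 * p j * S j j) = real d - 2 * (\<Sum>j=1..d. \<Sum>l<d. u l j * u l j * p j)"
    by (simp add: S_def sum_subtractf sum_distrib_left mult_ac)
  also have "(\<Sum>j=1..d. \<Sum>l<d. u l j * u l j * p j) = real d"
    by (subst sum.swap) (simp add: orthonormal[unfolded One_nat_def])
  \<comment> \<open>Expanding the square gives a fourfold sum that factors, for each pair
    \<open>k\<close>, \<open>l\<close>, into the square of the inner product of \<open>u k\<close>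
    and \<open>u l\<close>; only the \<open>d\<close> diagonal pairs survive.\<close>
  also have "(\<Sum>j=1..d. \<Sum>j'=1..d. p j * p j' * (S j j')\<^sup>2) = real d"
  proof -
    have "(\<Sum>j=1..d. \<Sum>j'=1..d. p j * p j' * (S j j')\<^sup>2)
        = (\<Sum>j=1..d. \<Sum>j'=1..d. \<Sum>k<d. \<Sum>l<d. (u k j * u l j * p j) * (u k j' * u l j' * p j'))"
    proof (intro sum.cong refl)
      fix j j'
      have "p j * p j' * (S j j')\<^sup>2 = p j * p j' * (\<Sum>k<d. \<Sum>l<d. (u k j * u k j') * (u l j * u l j'))"
        unfolding S_def power2_eq_square sum_product ..
      also have "\<dots> = (\<Sum>k<d. \<Sum>l<d. (u k j * u l j * p j) * (u k j' * u l j' * p j'))"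
        by (simp only: sum_distrib_left mult_ac)
      finally show "p j * p j' * (S j j')\<^sup>2
          = (\<Sum>k<d. \<Sum>l<d. (u k j * u l j * p j) * (u k j' * u l j' * p j'))" .
    qed
    also have "\<dots> = (\<Sum>k<d. \<Sum>l<d. \<Sum>j=1..d. \<Sum>j'=1..d. (u k j * u l j * p j) * (u k j' * u l j' * p j'))"
      by (simp only: sum_rotate[of _ "{..<d}" "{..<d}" "{1..d}"])
    also have "\<dots> = (\<Sum>k<d. \<Sum>l<d. of_bool (k = l))"
      by (intro sum.cong refl, subst sum_product[symmetric]) (auto simp: orthonormal[unfolded One_nat_def])
    also have "\<dots> = real d" by (simp add: of_bool_def)
    finally show ?thesis .
  qed
  finally have "(\<Sum>j=1..d. \<Sum>j'=1..d. p j * p j' * (\<Delta> j j')\<^sup>2) = 0" by simp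
  moreover have nn: "0 \<le> p j * p j' * (\<Delta> j j')\<^sup>2" if "j \<in> {1..d}" "j' \<in> {1..d}" for j j'
    using p_pos[OF that(1)] p_pos[OF that(2)] by simp
  ultimately have "(\<Sum>j'=1..d. p j * p j' * (\<Delta> j j')\<^sup>2) = 0"
    by (intro sum_nonneg_0[OF _ _ _ assms(1), where f = "\<lambda>j. \<Sum>j'=1..d. p j * p j' * (\<Delta> j j')\<^sup>2"] sum_nonneg) blast+
  hence "p j * p j' * (\<Delta> j j')\<^sup>2 = 0"
    by (intro sum_nonneg_0[OF _ _ _ assms(2), where f = "\<lambda>j'. p j * p j' * (\<Delta> j j')\<^sup>2"] nn assms(1)) blast+
  hence "\<Delta> j j' = 0" using p_pos[OF assms(1)] p_pos[OF assms(2)] by simp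
  thus ?thesis by (simp add: \<Delta>_def S_def)
qed

section \<open>Expansion of the Krawtchouk polynomials over words\<close>

abbreviation point_words :: "(nat \<Rightarrow>\<^sub>0 nat) \<Rightarrow> (nat \<Rightarrow> nat) set" where
  "point_words x \<equiv> typed_words N {1..d} x"

abbreviation index_words :: "(nat \<Rightarrow>\<^sub>0 nat) \<Rightarrow> (nat \<Rightarrow> nat) set" where
  "index_words n \<equiv> typed_words N {..<d} n"

text \<open>The tensor product of the basis functions named by \<open>b\<close>, evaluated at the
  word \<open>a\<close>.\<close>

definition U :: "(nat \<Rightarrow> nat) \<Rightarrow> (nat \<Rightarrow> nat) \<Rightarrow> real" where
  "U b a = (\<Prod>k<N. u (b k) (a k))"

abbreviation Q :: "(nat \<Rightarrow>\<^sub>0 nat) \<Rightarrow> (nat \<Rightarrow>\<^sub>0 nat) \<Rightarrow> real" where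
  "Q n x \<equiv> krawtchouk d u n x"

text \<open>Since \<open>u 0\<close> is 1 at every box, the constant term of each linear factor is
  the term of the letter 0. The generating function becomes a product over positions of sums over
  \<open>{..<d}\<close>, and its coefficient at \<open>n\<close> collects the index words of that
  type.\<close>

lemma krawtchouk_word_type:
  assumes a: "a \<in> words N {1..d}"
  shows "Q n (word_type N a) = (\<Sum>b\<in>index_words n. U b a)"
proof -
  have lin: "1 + (\<Sum>l=1..d-1. Poly_Mapping.single (Poly_Mapping.single l 1) (u l j))
      = (\<Sum>l<d. Poly_Mapping.single (letter l) (u l j))" if "j \<in> {1..d}" for j
    unfolding letters by (auto simp: letter_def u_0[OF that] intro!: sum.cong)
  have "krawtchouk_gen d u (word_type N a)
      = (\<Prod>j=1..d. (\<Sum>l<d. Poly_Mapping.single (letter l) (u l j)) ^ card {k. k < N \<and> a k = j})"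
    unfolding krawtchouk_gen_def
    by (intro prod.cong refl, subst lin, assumption) (simp add: lookup_word_type)
  also have "\<dots> = (\<Prod>k<N. \<Sum>l<d. Poly_Mapping.single (letter l) (u l (a k)))"
    by (rule prod_eq_prod_power_fibres[symmetric]) (use a in auto)
  finally show ?thesis
    by (simp add: krawtchouk_def lookup_prod_sum_letters U_def)
qed

text \<open>Both sides are the coefficient at \<open>x\<close> of a product of linear forms, one per letter of the index
  word, which does not change when the letters are permuted.\<close>
lemma sum_point_words_U_cong:
  assumes "b \<in> index_words n" "b' \<in> index_words n"
  shows "(\<Sum>a\<in>point_words x. U b a) = (\<Sum>a\<in>point_words x. U b' a)"
proof -
  define G where "G l = (\<Sum>j=1..d. Poly_Mapping.single (letter j) (u l j))" for l
  have card_eq: "card {k. k < N \<and> b k = l} = card {k. k < N \<and> b' k = l}" if "l < d" for l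
  proof -
    have pos: "card {k. k < N \<and> b k = l} = card {k. k < N \<and> b' k = l}" if "l \<noteq> 0" for l
      using assms that lookup_word_type[of N b l] lookup_word_type[of N b' l] by (simp add: typed_words_def)
    \<comment> \<open>The type does not record how often 0 occurs; equality of that count follows
      from the common length of the two words.\<close>
    have "(\<Sum>l<d. card {k. k < N \<and> b k = l}) = (\<Sum>l<d. card {k. k < N \<and> b' k = l})"
      using assms sum_card_fibres[of "{..<d}" b N] sum_card_fibres[of "{..<d}" b' N]
      by (simp add: typed_words_def)
    with pos show ?thesis unfolding letters by (cases "l = 0") (auto cong: sum.cong_simp)
  qed
  have gen: "(\<Sum>a\<in>point_words x. U b a) = Poly_Mapping.lookup (\<Prod>l<d. G l ^ card {k. k < N \<and> b k = l}) x"
    if "b \<in> index_words n" for b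
  proof -
    have "(\<Prod>l<d. G l ^ card {k. k < N \<and> b k = l}) = (\<Prod>k<N. G (b k))"
      by (rule prod_eq_prod_power_fibres[symmetric]) (use that in \<open>auto simp: typed_words_def\<close>)
    thus ?thesis by (simp add: G_def lookup_prod_sum_letters U_def)
  qed
  show ?thesis unfolding gen[OF assms(1)] gen[OF assms(2)] by (simp add: card_eq)
qed

text \<open>Double counting of \<open>U\<close> over all pairs of an index word and a configuration
  word. Summing over configurations first gives the same value for every index word; summing over
  index words first gives \<open>Q n x\<close> each time. This exchanges an average over index words
  for one over configuration words.\<close>

lemma card_mult_sum_point_words_U:
  assumes b: "b \<in> index_words n"
  shows "real (card (index_words n)) * (\<Sum>a\<in>point_words x. U b a) = real (card (point_words x)) * Q n x"
proof -
  have "real (card (index_words n)) * (\<Sum>a\<in>point_words x. U b a) = (\<Sum>b'\<in>index_words n. \<Sum>a\<in>point_words x. U b a)"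
    by simp
  also have "\<dots> = (\<Sum>b'\<in>index_words n. \<Sum>a\<in>point_words x. U b' a)"
    by (intro sum.cong[OF refl] sum_point_words_U_cong[OF b])
  also have "\<dots> = (\<Sum>a\<in>point_words x. \<Sum>b'\<in>index_words n. U b' a)" by (rule sum.swap)
  also have "\<dots> = (\<Sum>a\<in>point_words x. Q n x)"
  proof (rule sum.cong[OF refl])
    fix a assume "a \<in> point_words x"
    thus "(\<Sum>b'\<in>index_words n. U b' a) = Q n x"
      using krawtchouk_word_type[of a n] by (simp add: typed_words_def)
  qed
  finally show ?thesis by simp
qed

text \<open>In a product of two polynomials of the same index the half powers combine, and the
  square root becomes division by the number of index words.\<close>

lemma krawtchouk_on_mult:
  assumes "n \<in> weak_comps (d - 1) i" "i \<le> N"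
  shows "krawtchouk_on d N u n x * krawtchouk_on d N u n y = Q n x * Q n y / card (index_words n)"
proof -
  have c: "real (card (index_words n)) = index_coeff d N n"
    using card_typed_words_indices assms d_pos by simp
  have pos: "index_coeff d N n > 0" by (simp add: index_coeff_def prod_pos)
  have "krawtchouk_on d N u n x * krawtchouk_on d N u n y
      = (index_coeff d N n powr (- 1 / 2) * index_coeff d N n powr (- 1 / 2)) * (Q n x * Q n y)"
    by (simp only: krawtchouk_on_def mult_ac)
  also have "index_coeff d N n powr (- 1 / 2) * index_coeff d N n powr (- 1 / 2) = 1 / index_coeff d N n"
    using pos by (simp add: powr_add[symmetric] powr_minus_divide)
  finally show ?thesis by (simp add: c)
qed

section \<open>Multinomial expectations and orthonormality\<close>

lemma prod_p_points:
  assumes "a \<in> point_words x"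
  shows "(\<Prod>k<N. p (a k)) = (\<Prod>j=1..d. p j ^ Poly_Mapping.lookup x j)"
proof -
  have a: "a \<in> words N {1..d}" "word_type N a = x" using assms by (auto simp: typed_words_def)
  show ?thesis
    unfolding a(2)[symmetric] prod_eq_prod_power_fibres[OF finite_atLeastAtMost a(1), of p]
    by (intro prod.cong refl) (simp add: lookup_word_type)
qed

text \<open>The multinomial law is the law of the type of a word with independent letters drawn from
  \<open>p\<close>: all words of one type are equally likely, and their number is the multinomial
  coefficient.\<close>

lemma sum_multinomial:
  fixes f :: "(nat \<Rightarrow>\<^sub>0 nat) \<Rightarrow> real"
  shows "(\<Sum>x\<in>weak_comps d N. multinomial d N p x * f x)
    = (\<Sum>a\<in>words N {1..d}. (\<Prod>k<N. p (a k)) * f (word_type N a))"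
proof -
  have "multinomial d N p x * f x = (\<Sum>a\<in>{a \<in> words N {1..d}. word_type N a = x}. (\<Prod>k<N. p (a k)) * f (word_type N a))"
    if x: "x \<in> weak_comps d N" for x
  proof -
    have "(\<Prod>k<N. p (a k)) = (\<Prod>j=1..d. p j ^ Poly_Mapping.lookup x j)" if "a \<in> point_words x" for a
      using that by (rule prod_p_points)
    hence "(\<Sum>a\<in>point_words x. (\<Prod>k<N. p (a k)) * f (word_type N a))
        = (\<Sum>a\<in>point_words x. (\<Prod>j=1..d. p j ^ Poly_Mapping.lookup x j) * f x)"
      by (intro sum.cong refl) (simp add: typed_words_def)
    thus ?thesis
      using card_typed_words_points[OF x] by (simp add: typed_words_def multinomial_def)
  qed
  hence "(\<Sum>x\<in>weak_comps d N. multinomial d N p x * f x)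
      = (\<Sum>x\<in>weak_comps d N. \<Sum>a\<in>{a \<in> words N {1..d}. word_type N a = x}. (\<Prod>k<N. p (a k)) * f (word_type N a))"
    by (rule sum.cong[OF refl])
  also have "\<dots> = (\<Sum>a\<in>words N {1..d}. (\<Prod>k<N. p (a k)) * f (word_type N a))"
    by (rule sum.group) (auto simp: weak_comps_eq_image)
  finally show ?thesis .
qed

lemma multinomial_pos: "x \<in> weak_comps d N \<Longrightarrow> multinomial d N p x > 0"
  unfolding multinomial_def by (intro mult_pos_pos divide_pos_pos prod_pos zero_less_power p_pos) auto

lemma sum_multinomial_eq_1: "(\<Sum>x\<in>weak_comps d N. multinomial d N p x) = 1"
proof -
  have "(\<Sum>x\<in>weak_comps d N. multinomial d N p x) = (\<Prod>k<N. \<Sum>j=1..d. p j)"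
    using sum_multinomial[of "\<lambda>_. 1"] by (subst prod_sum_PiE) auto
  thus ?thesis unfolding p_sum by simp
qed

text \<open>The expectation of \<open>U b * U b'\<close> over random words factors into one inner
  product of \<open>u\<close> per position, hence is 1 or 0 according to whether
  \<open>b = b'\<close>. The expectation of \<open>Q n * Q n'\<close> thus counts the common index
  words: none for different types, \<open>index_coeff\<close> for equal ones.\<close>

lemma krawtchouk_on_orthonormal:
  assumes "n \<in> weak_comps (d - 1) i" "i \<le> N" "n' \<in> weak_comps (d - 1) i'" "i' \<le> N"
  shows "(\<Sum>x\<in>weak_comps d N. multinomial d N p x * (krawtchouk_on d N u n x * krawtchouk_on d N u n' x))
    = of_bool (n = n')"
proof -
  have c: "real (card (index_words n)) = index_coeff d N n"
    using card_typed_words_indices assms d_pos by simp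
  have pos: "index_coeff d N n > 0" by (simp add: index_coeff_def prod_pos)
  have "(\<Sum>x\<in>weak_comps d N. multinomial d N p x * (Q n x * Q n' x))
      = (\<Sum>a\<in>words N {1..d}. (\<Prod>k<N. p (a k)) * ((\<Sum>b\<in>index_words n. U b a) * (\<Sum>b'\<in>index_words n'. U b' a)))"
    unfolding sum_multinomial by (intro sum.cong refl) (simp add: krawtchouk_word_type)
  also have "\<dots> = (\<Sum>a\<in>words N {1..d}. \<Sum>b\<in>index_words n. \<Sum>b'\<in>index_words n'.
      \<Prod>k<N. u (b k) (a k) * u (b' k) (a k) * p (a k))"
  proof (rule sum.cong[OF refl])
    fix a
    have "(\<Prod>k<N. p (a k)) * ((\<Sum>b\<in>index_words n. U b a) * (\<Sum>b'\<in>index_words n'. U b' a))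
        = (\<Prod>k<N. p (a k)) * (\<Sum>b\<in>index_words n. \<Sum>b'\<in>index_words n'. U b a * U b' a)"
      by (simp only: sum_product)
    also have "\<dots> = (\<Sum>b\<in>index_words n. \<Sum>b'\<in>index_words n'. \<Prod>k<N. u (b k) (a k) * u (b' k) (a k) * p (a k))"
      by (simp only: sum_distrib_left U_def prod.distrib mult_ac)
    finally show "(\<Prod>k<N. p (a k)) * ((\<Sum>b\<in>index_words n. U b a) * (\<Sum>b'\<in>index_words n'. U b' a))
        = (\<Sum>b\<in>index_words n. \<Sum>b'\<in>index_words n'. \<Prod>k<N. u (b k) (a k) * u (b' k) (a k) * p (a k))" .
  qed
  also have "\<dots> = (\<Sum>b\<in>index_words n. \<Sum>b'\<in>index_words n'. \<Sum>a\<in>words N {1..d}.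
      \<Prod>k<N. u (b k) (a k) * u (b' k) (a k) * p (a k))"
    by (rule sum_rotate)
  also have "\<dots> = (\<Sum>b\<in>index_words n. \<Sum>b'\<in>index_words n'. of_bool (b = b'))"
  proof (intro sum.cong refl)
    fix b b' assume bb: "b \<in> index_words n" "b' \<in> index_words n'"
    have "(\<Sum>a\<in>words N {1..d}. \<Prod>k<N. u (b k) (a k) * u (b' k) (a k) * p (a k))
        = (\<Prod>k<N. \<Sum>j=1..d. u (b k) j * u (b' k) j * p j)"
      by (subst prod_sum_PiE) auto
    also have "\<dots> = (\<Prod>k<N. of_bool (b k = b' k))"
      using bb by (intro prod.cong refl orthonormal) (auto simp: typed_words_def)
    also have "\<dots> = of_bool (b = b')"
    proof (cases "b = b'")
      case False
      then obtain k where "k < N" "b k \<noteq> b' k"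
        using bb PiE_ext[of b "{..<N}" "\<lambda>_. {..<d}" b'] by (auto simp: typed_words_def)
      thus ?thesis using False by (auto intro!: prod_zero bexI[of _ k])
    qed simp
    finally show "(\<Sum>a\<in>words N {1..d}. \<Prod>k<N. u (b k) (a k) * u (b' k) (a k) * p (a k)) = of_bool (b = b')" .
  qed
  also have "\<dots> = of_bool (n = n') * index_coeff d N n"
  proof (cases "n = n'")
    case True
    thus ?thesis using c by (simp add: of_bool_def)
  next
    case False
    hence "b \<noteq> b'" if "b \<in> index_words n" "b' \<in> index_words n'" for b b'
      using that by (auto simp: typed_words_def)
    thus ?thesis using False by simp
  qed
  finally have "(\<Sum>x\<in>weak_comps d N. multinomial d N p x * (Q n x * Q n' x)) = of_bool (n = n') * index_coeff d N n" .
  moreover have "multinomial d N p x * (krawtchouk_on d N u n x * krawtchouk_on d N u n' x)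
      = (index_coeff d N n powr (- 1 / 2) * index_coeff d N n' powr (- 1 / 2))
        * (multinomial d N p x * (Q n x * Q n' x))" for x
    by (simp only: krawtchouk_on_def mult_ac)
  ultimately have "(\<Sum>x\<in>weak_comps d N. multinomial d N p x * (krawtchouk_on d N u n x * krawtchouk_on d N u n' x))
      = (index_coeff d N n powr (- 1 / 2) * index_coeff d N n' powr (- 1 / 2)) * (of_bool (n = n') * index_coeff d N n)"
    by (simp only: sum_distrib_left[symmetric])
  also have "\<dots> = of_bool (n = n')"
    using pos by (auto simp: powr_add[symmetric] powr_minus_divide)
  finally show ?thesis .
qed

text \<open>The only index word of type 0 is the constant word 0, and \<open>u 0\<close> is 1. This
  constant is the source of the \<open>-1\<close> in the chi-squared identity and of the vanishing
  means in the limit law.\<close>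

lemma krawtchouk_on_0:
  assumes "x \<in> weak_comps d N"
  shows "krawtchouk_on d N u 0 x = 1"
proof -
  obtain a where a: "a \<in> words N {1..d}" "x = word_type N a"
    using assms by (auto simp: weak_comps_eq_image)
  have "index_words 0 = {\<lambda>k\<in>{..<N}. 0}"
  proof (intro equalityI subsetI)
    fix b assume b: "b \<in> index_words 0"
    have "b k = 0" if "k < N" for k
    proof (rule ccontr)
      assume "b k \<noteq> 0"
      then have "card {k'. k' < N \<and> b k' = b k} = 0"
        using b lookup_word_type[of N b "b k"] by (simp add: typed_words_def)
      thus False using that by auto
    qed
    thus "b \<in> {\<lambda>k\<in>{..<N}. 0}" using b by (auto simp: typed_words_def fun_eq_iff PiE_iff extensional_def)
  qed (use d_pos in \<open>auto simp: typed_words_def word_type_def letter_def\<close>)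
  hence "Q 0 x = (\<Prod>k<N. u 0 (a k))"
    by (simp add: a(2) krawtchouk_word_type[OF a(1)] U_def)
  also have "\<dots> = 1" using a(1) u_0 by (intro prod.neutral ballI) (metis PiE_mem)
  finally show ?thesis by (simp add: krawtchouk_on_def index_coeff_def)
qed


text \<open>By \<open>dual_orthonormal\<close> this is the sum of \<open>u l j * u l j'\<close> over
  nonzero \<open>l\<close>, that is, the kernel of the projection that removes constants in the
  weighted space of functions on the boxes.\<close>

definition R :: "nat \<Rightarrow> nat \<Rightarrow> real" where
  "R j j' = of_bool (j = j') / p j - 1"

section \<open>The generating function of the kernels\<close>

lemma sum_index_words_of_degree:
  assumes "i \<le> N"
  shows "(\<Sum>n\<in>weak_comps (d - 1) i. \<Sum>b\<in>index_words n. f b)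
    = (\<Sum>b\<in>{b \<in> words N {..<d}. card {k. k < N \<and> b k \<noteq> 0} = i}. f b)"
proof -
  have iff: "word_type N b \<in> weak_comps (d - 1) i \<longleftrightarrow> card {k. k < N \<and> b k \<noteq> 0} = i"
    if "b \<in> words N {..<d}" for b
    using word_type_degree[OF that] by (auto simp: weak_comps_def)
  have "(\<Sum>n\<in>weak_comps (d - 1) i. \<Sum>b\<in>index_words n. f b)
      = (\<Sum>n\<in>weak_comps (d - 1) i. \<Sum>b\<in>{b \<in> {b \<in> words N {..<d}. card {k. k < N \<and> b k \<noteq> 0} = i}. word_type N b = n}. f b)"
  proof (rule sum.cong[OF refl])
    fix n assume "n \<in> weak_comps (d - 1) i"
    hence "index_words n = {b \<in> {b \<in> words N {..<d}. card {k. k < N \<and> b k \<noteq> 0} = i}. word_type N b = n}"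
      unfolding typed_words_def using iff by blast
    thus "(\<Sum>b\<in>index_words n. f b) = (\<Sum>b\<in>{b \<in> {b \<in> words N {..<d}. card {k. k < N \<and> b k \<noteq> 0} = i}. word_type N b = n}. f b)"
      by simp
  qed
  also have "\<dots> = (\<Sum>b\<in>{b \<in> words N {..<d}. card {k. k < N \<and> b k \<noteq> 0} = i}. f b)"
    by (rule sum.group) (use iff in auto)
  finally show ?thesis .
qed

text \<open>The polynomial variable marks nonzero letters. At each position the letter 0 contributes
  1 and the other letters together contribute \<open>R\<close> times the variable, so coefficient
  \<open>i\<close> collects the words with exactly \<open>i\<close> nonzero letters.\<close>

lemma sum_U_mult_U:
  assumes "a \<in> words N {1..d}" "a' \<in> words N {1..d}"
  shows "(\<Sum>b\<in>{b \<in> words N {..<d}. card {k. k < N \<and> b k \<noteq> 0} = i}. U b a * U b a')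
    = coeff (\<Prod>k<N. [:1, R (a k) (a' k):]) i"
proof -
  have lin: "[:1, R (a k) (a' k):] = (\<Sum>l<d. monom (u l (a k) * u l (a' k)) (of_bool (l \<noteq> 0)))"
    if "k < N" for k
  proof -
    have mem: "a k \<in> {1..d}" "a' k \<in> {1..d}" using PiE_mem[OF assms(1)] PiE_mem[OF assms(2)] that by blast+
    have "(\<Sum>l=1..d-1. u l (a k) * u l (a' k)) = R (a k) (a' k)"
      using dual_orthonormal[OF mem] u_0[OF mem(1)] u_0[OF mem(2)]
      unfolding letters R_def by simp
    moreover have "(\<Sum>l=1..d-1. monom (u l (a k) * u l (a' k)) (of_bool (l \<noteq> 0)))
        = monom (\<Sum>l=1..d-1. u l (a k) * u l (a' k)) 1"
      by (simp add: monom_sum)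
    ultimately show ?thesis
      unfolding letters using u_0[OF mem(1)] u_0[OF mem(2)]
      by (simp add: monom_0 monom_Suc)
  qed
  have prod: "(\<Prod>k\<in>K. monom (c k) (e k)) = monom (\<Prod>k\<in>K. c k) (\<Sum>k\<in>K. e k)"
    if "finite K" for K and c :: "nat \<Rightarrow> real" and e :: "nat \<Rightarrow> nat"
    using that by (induction K rule: finite_induct) (auto simp: mult_monom)
  have deg: "(\<Sum>k<N. of_bool (b k \<noteq> 0)) = card {k. k < N \<and> b k \<noteq> 0}" for b :: "nat \<Rightarrow> nat"
    by (auto simp: of_bool_def sum.If_cases intro!: arg_cong[where f = card])
  have "(\<Prod>k<N. [:1, R (a k) (a' k):]) = (\<Prod>k<N. \<Sum>l<d. monom (u l (a k) * u l (a' k)) (of_bool (l \<noteq> 0)))"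
    by (intro prod.cong refl lin) auto
  also have "\<dots> = (\<Sum>b\<in>words N {..<d}. \<Prod>k<N. monom (u (b k) (a k) * u (b k) (a' k)) (of_bool (b k \<noteq> 0)))"
    by (rule prod_sum_PiE) auto
  also have "\<dots> = (\<Sum>b\<in>words N {..<d}. monom (U b a * U b a') (card {k. k < N \<and> b k \<noteq> 0}))"
    by (simp only: prod[OF finite_lessThan] deg U_def prod.distrib)
  finally show ?thesis by (simp add: coeff_sum sum.inter_filter)
qed

text \<open>The right-hand side does not mention \<open>u\<close>: by the dual relation, \<open>R\<close> depends on \<open>p\<close> only.\<close>
lemma krawtchouk_kernel_eq:
  assumes x: "x \<in> weak_comps d N" and a': "a' \<in> point_words y" and "i \<le> N"
  shows "krawtchouk_kernel d N u i x y
    = (\<Sum>a\<in>point_words x. coeff (\<Prod>k<N. [:1, R (a k) (a' k):]) i) / card (point_words x)"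
proof -
  have cx: "real (card (point_words x)) > 0"
    using card_typed_words_points[OF x] by (simp add: prod_pos)
  have a'w: "a' \<in> words N {1..d}" "word_type N a' = y" using a' by (auto simp: typed_words_def)
  have "krawtchouk_kernel d N u i x y = (\<Sum>n\<in>weak_comps (d - 1) i. Q n x * Q n y / card (index_words n))"
    unfolding krawtchouk_kernel_def
    by (rule sum.cong[OF refl], rule krawtchouk_on_mult) (use \<open>i \<le> N\<close> in auto)
  also have "\<dots> = (\<Sum>n\<in>weak_comps (d - 1) i. \<Sum>b\<in>index_words n. (\<Sum>a\<in>point_words x. U b a * U b a') / card (point_words x))"
  proof (rule sum.cong[OF refl])
    fix n assume n: "n \<in> weak_comps (d - 1) i"
    have cn: "real (card (index_words n)) > 0"
      using card_typed_words_indices[OF n \<open>i \<le> N\<close> d_pos] by (simp add: index_coeff_def prod_pos)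
    \<comment> \<open>The two arguments are treated differently: \<open>Q n y\<close> is expanded
      over index words \<open>b\<close> at the single word \<open>a'\<close>, while
      \<open>Q n x\<close> divided by the number of index words becomes, for each such
      \<open>b\<close>, the average of \<open>U b\<close> over the words of
      \<open>x\<close>.\<close>
    have cross: "q / A = s / c" if "A * s = c * q" "A > 0" "c > 0" for A s c q :: real
      using that by (simp add: field_simps)
    have "Q n x * Q n y / card (index_words n) = (\<Sum>b\<in>index_words n. U b a') * (Q n x / card (index_words n))"
      using krawtchouk_word_type[OF a'w(1), of n] a'w(2) by simp
    also have "\<dots> = (\<Sum>b\<in>index_words n. U b a' * (Q n x / card (index_words n)))"
      by (rule sum_distrib_right)
    also have "\<dots> = (\<Sum>b\<in>index_words n. (\<Sum>a\<in>point_words x. U b a * U b a') / card (point_words x))"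
    proof (rule sum.cong[OF refl])
      fix b assume b: "b \<in> index_words n"
      have "U b a' * (Q n x / card (index_words n)) = U b a' * ((\<Sum>a\<in>point_words x. U b a) / card (point_words x))"
        using cross[OF card_mult_sum_point_words_U[OF b] cn cx] by simp
      thus "U b a' * (Q n x / card (index_words n)) = (\<Sum>a\<in>point_words x. U b a * U b a') / card (point_words x)"
        by (simp add: sum_distrib_right[symmetric] mult.commute)
    qed
    finally show "Q n x * Q n y / card (index_words n)
        = (\<Sum>b\<in>index_words n. (\<Sum>a\<in>point_words x. U b a * U b a') / card (point_words x))" .
  qed
  also have "\<dots> = (\<Sum>a\<in>point_words x. (\<Sum>b\<in>{b \<in> words N {..<d}. card {k. k < N \<and> b k \<noteq> 0} = i}. U b a * U b a')) / card (point_words x)"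
    unfolding sum_index_words_of_degree[OF \<open>i \<le> N\<close>] by (subst sum.swap) (simp add: sum_divide_distrib)
  also have "\<dots> = (\<Sum>a\<in>point_words x. coeff (\<Prod>k<N. [:1, R (a k) (a' k):]) i) / card (point_words x)"
    by (rule arg_cong2[where f = "(/)", OF sum.cong[OF refl] refl], rule sum_U_mult_U[OF _ a'w(1)])
      (simp add: typed_words_def)
  finally show ?thesis .
qed

text \<open>At the value 1 of the variable each factor \<open>1 + R\<close> is a delta divided by
  \<open>p\<close>, so only the word \<open>a = a'\<close> survives in the average, and it is a word
  of \<open>x\<close> exactly when \<open>x = y\<close>. Its weight is the reciprocal of its
  probability times the number of words of \<open>x\<close>, which is the reciprocal multinomial
  probability.\<close>

lemma sum_krawtchouk_kernel:
  assumes x: "x \<in> weak_comps d N" and y: "y \<in> weak_comps d N"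
  shows "(\<Sum>i\<le>N. krawtchouk_kernel d N u i x y) = of_bool (x = y) / multinomial d N p x"
proof -
  obtain a' where a': "a' \<in> words N {1..d}" "word_type N a' = y"
    using y by (auto simp: weak_comps_eq_image)
  hence a'y: "a' \<in> point_words y" by (simp add: typed_words_def)
  have deg: "degree (\<Prod>k<N. [:1, c k:]) \<le> N" for c :: "nat \<Rightarrow> real"
  proof -
    have "degree (\<Prod>k<N. [:1, c k:]) \<le> sum (degree \<circ> (\<lambda>k. [:1, c k:])) {..<N}"
      by (rule degree_prod_sum_le) simp
    also have "\<dots> \<le> (\<Sum>k<N. 1)" by (intro sum_mono) auto
    finally show ?thesis by simp
  qed
  \<comment> \<open>Summing coefficients up to \<open>N\<close> is evaluation at 1, because a
    product of \<open>N\<close> linear factors has degree at most \<open>N\<close>.\<close>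
  have at1: "(\<Sum>i\<le>N. coeff q i) = poly q 1" if "degree q \<le> N" for q :: "real poly"
  proof -
    have "(\<Sum>i\<le>N. coeff q i) = (\<Sum>i\<le>degree q. coeff q i)"
      using that by (intro sum.mono_neutral_right) (auto simp: coeff_eq_0)
    thus ?thesis by (simp add: poly_altdef)
  qed
  have vals: "(\<Sum>i\<le>N. coeff (\<Prod>k<N. [:1, R (a k) (a' k):]) i) = of_bool (a = a') / (\<Prod>k<N. p (a' k))"
    if "a \<in> point_words x" for a
  proof -
    have "(\<Sum>i\<le>N. coeff (\<Prod>k<N. [:1, R (a k) (a' k):]) i) = (\<Prod>k<N. of_bool (a k = a' k) / p (a k))"
      by (simp add: at1[OF deg] poly_prod R_def)
    also have "\<dots> = of_bool (a = a') / (\<Prod>k<N. p (a' k))"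
    proof (cases "a = a'")
      case False
      have aw: "a \<in> words N {1..d}" using that by (simp add: typed_words_def)
      have "\<exists>k\<in>{..<N}. a k \<noteq> a' k"
        using PiE_ext[OF aw a'(1)] False by metis
      hence "(\<Prod>k<N. of_bool (a k = a' k) / p (a k)) = 0"
        by (intro prod_zero) auto
      thus ?thesis using False by simp
    qed (simp add: prod_dividef)
    finally show ?thesis .
  qed
  have "(\<Sum>i\<le>N. krawtchouk_kernel d N u i x y)
      = (\<Sum>i\<le>N. (\<Sum>a\<in>point_words x. coeff (\<Prod>k<N. [:1, R (a k) (a' k):]) i) / card (point_words x))"
    by (intro sum.cong refl krawtchouk_kernel_eq x a'y) auto
  also have "\<dots> = (\<Sum>a\<in>point_words x. \<Sum>i\<le>N. coeff (\<Prod>k<N. [:1, R (a k) (a' k):]) i) / card (point_words x)"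
    by (subst sum.swap) (simp add: sum_divide_distrib)
  also have "\<dots> = (\<Sum>a\<in>point_words x. if a = a' then 1 / (\<Prod>k<N. p (a' k)) else 0) / card (point_words x)"
    by (intro arg_cong2[where f = "(/)"] sum.cong refl) (simp add: vals)
  also have "\<dots> = of_bool (a' \<in> point_words x) / ((\<Prod>k<N. p (a' k)) * card (point_words x))"
    by simp
  also have "a' \<in> point_words x \<longleftrightarrow> x = y" using a' by (auto simp: typed_words_def)
  also have "of_bool (x = y) / ((\<Prod>k<N. p (a' k)) * card (point_words x)) = of_bool (x = y) / multinomial d N p x"
  proof (cases "x = y")
    case True
    have "(\<Prod>k<N. p (a' k)) = (\<Prod>j=1..d. p j ^ Poly_Mapping.lookup x j)"
      using prod_p_points a'y True by simp
    thus ?thesis using card_typed_words_points[OF x] by (simp add: multinomial_def mult.commute)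
  qed simp
  finally show ?thesis .
qed

text \<open>An index word of this type has the letter \<open>l\<close> at one position and 0
  elsewhere, so \<open>U\<close> reduces to \<open>u l\<close> at that position. Summing over
  positions and grouping them by box gives a function linear in the configuration.\<close>

lemma krawtchouk_degree_1:
  assumes x: "x \<in> weak_comps d N" and l: "l \<in> {1..d-1}"
  shows "krawtchouk d u (Poly_Mapping.single l 1) x = (\<Sum>j=1..d. real (Poly_Mapping.lookup x j) * u l j)"
proof -
  obtain a where a: "a \<in> words N {1..d}" "x = word_type N a"
    using x by (auto simp: weak_comps_eq_image)
  define e where "e k0 = (\<lambda>k\<in>{..<N}. if k = k0 then l else 0)" for k0
  have ld: "0 < l" "l < d" using l by auto
  have "index_words (Poly_Mapping.single l 1) = e ` {..<N}"
  proof (intro equalityI subsetI)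
    fix b assume b: "b \<in> index_words (Poly_Mapping.single l 1)"
    have lk: "card {k. k < N \<and> b k = m} = (if m = l then 1 else 0)" if "m \<noteq> 0" for m
    proof -
      have "Poly_Mapping.lookup (word_type N b) m = Poly_Mapping.lookup (Poly_Mapping.single l 1) m"
        using b by (simp add: typed_words_def)
      thus ?thesis using that by (auto simp only: lookup_word_type lookup_single when_def split: if_splits)
    qed
    obtain k0 where k0: "{k. k < N \<and> b k = l} = {k0}"
      using lk[of l] ld by (auto simp: card_1_singleton_iff)
    have mem: "k < N \<and> b k = l \<longleftrightarrow> k = k0" for k
      using k0 unfolding set_eq_iff mem_Collect_eq singleton_iff by blast
    have "b k = (if k = k0 then l else 0)" if "k < N" for k
    proof (cases "b k = 0")
      case True thus ?thesis using mem[of k] ld that by auto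
    next
      case False
      have "finite {k'. k' < N \<and> b k' = b k}" "k \<in> {k'. k' < N \<and> b k' = b k}" using that by auto
      hence "card {k'. k' < N \<and> b k' = b k} \<noteq> 0" by (metis card_0_eq empty_iff)
      hence "b k = l" using lk[OF False] by metis
      thus ?thesis using mem[of k] that by simp
    qed
    hence "b = e k0" using b by (auto simp: e_def typed_words_def fun_eq_iff PiE_iff extensional_def)
    moreover have "k0 < N" using mem[of k0] by simp
    ultimately show "b \<in> e ` {..<N}" by auto
  next
    fix b assume "b \<in> e ` {..<N}"
    then obtain k0 where k0: "k0 < N" "b = e k0" by auto
    have "word_type N b = (\<Sum>k<N. if k = k0 then letter l else 0)"
      unfolding word_type_def k0(2) by (intro sum.cong) (auto simp: e_def letter_def)
    also have "\<dots> = Poly_Mapping.single l 1" using k0(1) ld by (simp add: letter_def)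
    finally show "b \<in> index_words (Poly_Mapping.single l 1)"
      using k0 ld by (auto simp: typed_words_def e_def)
  qed
  moreover have "inj_on e {..<N}"
  proof (rule inj_onI)
    fix k k' assume "k \<in> {..<N}" "k' \<in> {..<N}" "e k = e k'"
    hence "e k k = e k' k" "k < N" by auto
    thus "k = k'" using ld by (simp add: e_def split: if_splits)
  qed
  ultimately have "Q (Poly_Mapping.single l 1) x = (\<Sum>k0<N. U (e k0) a)"
    unfolding a(2) krawtchouk_word_type[OF a(1)] by (simp only: sum.reindex o_def)
  also have "\<dots> = (\<Sum>k0<N. u l (a k0))"
  proof (rule sum.cong[OF refl])
    fix k0 assume k0: "k0 \<in> {..<N}"
    have "U (e k0) a = (\<Prod>k<N. if k = k0 then u l (a k) else 1)"
      unfolding U_def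
    proof (rule prod.cong[OF refl])
      fix k assume "k \<in> {..<N}"
      thus "u (e k0 k) (a k) = (if k = k0 then u l (a k) else 1)"
        using u_0[OF PiE_mem[OF a(1)]] by (simp add: e_def)
    qed
    thus "U (e k0) a = u l (a k0)" using k0 by simp
  qed
  also have "\<dots> = (\<Sum>j=1..d. \<Sum>k\<in>{k\<in>{..<N}. a k = j}. u l (a k))"
    by (rule sum.group[symmetric]) (use a(1) in auto)
  also have "\<dots> = (\<Sum>j=1..d. real (Poly_Mapping.lookup x j) * u l j)"
    by (intro sum.cong refl) (simp add: a(2) lookup_word_type)
  finally show ?thesis by (simp add:)
qed

subsection \<open>The transform of the empirical measure\<close>

lemma emp_power_eq_kernel:
  "emp_power d N u r X i = (\<Sum>x\<in>weak_comps d N. \<Sum>y\<in>weak_comps d N.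
     krawtchouk_kernel d N u i x y * emp r X x * emp r X y)"
proof -
  have "emp_power d N u r X i = (\<Sum>n\<in>weak_comps (d - 1) i. \<Sum>x\<in>weak_comps d N. \<Sum>y\<in>weak_comps d N.
      krawtchouk_on d N u n x * krawtchouk_on d N u n y * emp r X x * emp r X y)"
    unfolding emp_power_def emp_transform_def power2_abs
    by (simp only: power2_eq_square sum_product mult_ac)
  also have "\<dots> = (\<Sum>x\<in>weak_comps d N. \<Sum>y\<in>weak_comps d N. \<Sum>n\<in>weak_comps (d - 1) i.
      krawtchouk_on d N u n x * krawtchouk_on d N u n y * emp r X x * emp r X y)"
    by (rule sum_rotate)
  finally show ?thesis by (simp add: krawtchouk_kernel_def sum_distrib_right)
qed

context
  fixes r :: nat and X :: "nat \<Rightarrow> (nat \<Rightarrow>\<^sub>0 nat)"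
  assumes r: "1 \<le> r" and X: "\<And>k. k \<in> {1..r} \<Longrightarrow> X k \<in> weak_comps d N"
begin

lemma sum_emp_eq_1: "(\<Sum>x\<in>weak_comps d N. emp r X x) = 1"
  using sum_emp[OF finite_weak_comps X, where f = "\<lambda>_. 1"] r by simp

lemma emp_power_0: "emp_power d N u r X 0 = 1"
proof -
  have "emp_transform d N u r X 0 = (\<Sum>x\<in>weak_comps d N. emp r X x)"
    unfolding emp_transform_def by (intro sum.cong refl) (simp add: krawtchouk_on_0)
  thus ?thesis by (simp add: emp_power_def weak_comps_0 sum_emp_eq_1)
qed

text \<open>A Parseval identity: the kernels of all degrees add up to the diagonal with weights
  \<open>1 / multinomial\<close>, so all powers together give the weighted sum of squares of the
  empirical measure. Removing degree 0, whose power is 1, leaves the centred sum of squares.\<close>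

lemma sum_emp_power:
  "(\<Sum>i=1..N. real r * emp_power d N u r X i) = chi_square_stat (weak_comps d N) (multinomial d N p) r X"
proof -
  let ?m = "multinomial d N p"
  have "(\<Sum>i\<le>N. emp_power d N u r X i) = (\<Sum>x\<in>weak_comps d N. \<Sum>y\<in>weak_comps d N.
      (\<Sum>i\<le>N. krawtchouk_kernel d N u i x y) * (emp r X x * emp r X y))"
    unfolding emp_power_eq_kernel
    by (simp only: sum_rotate[of _ _ _ "{..N}"] sum_distrib_right mult.assoc)
  also have "\<dots> = (\<Sum>x\<in>weak_comps d N. \<Sum>y\<in>weak_comps d N. if x = y then (emp r X x)\<^sup>2 / ?m x else 0)"
    by (intro sum.cong refl) (simp add: sum_krawtchouk_kernel power2_eq_square)
  also have "\<dots> = (\<Sum>x\<in>weak_comps d N. (emp r X x)\<^sup>2 / ?m x)"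
    by simp
  finally have all: "(\<Sum>i\<le>N. emp_power d N u r X i) = (\<Sum>x\<in>weak_comps d N. (emp r X x)\<^sup>2 / ?m x)" .
  have "{..N} = insert 0 {1..N}" by auto
  hence "(\<Sum>i=1..N. emp_power d N u r X i) = (\<Sum>i\<le>N. emp_power d N u r X i) - 1"
    by (simp add: emp_power_0)
  hence "(\<Sum>i=1..N. real r * emp_power d N u r X i) = real r * ((\<Sum>x\<in>weak_comps d N. (emp r X x)\<^sup>2 / ?m x) - 1)"
    by (simp add: all sum_distrib_left[symmetric])
  \<comment> \<open>The \<open>-1\<close> is written as \<open>-2 + 1\<close>, with both totals
    replaced by sums of probabilities, so that the square can be completed termwise.\<close>
  also have "\<dots> = real r * ((\<Sum>x\<in>weak_comps d N. (emp r X x)\<^sup>2 / ?m x)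
      - 2 * (\<Sum>x\<in>weak_comps d N. emp r X x) + (\<Sum>x\<in>weak_comps d N. ?m x))"
    by (simp add: sum_emp_eq_1 sum_multinomial_eq_1)
  also have "\<dots> = (\<Sum>x\<in>weak_comps d N. real r * ((emp r X x)\<^sup>2 / ?m x - 2 * emp r X x + ?m x))"
    by (simp add: sum_distrib_left[symmetric] sum.distrib sum_subtractf)
  also have "\<dots> = chi_square_stat (weak_comps d N) ?m r X"
    unfolding chi_square_stat_def
  proof (rule sum.cong[OF refl])
    fix x assume "x \<in> weak_comps d N"
    then have "?m x > 0" by (rule multinomial_pos)
    thus "real r * ((emp r X x)\<^sup>2 / ?m x - 2 * emp r X x + ?m x)
        = (real (sample_count r X x) - real r * ?m x)\<^sup>2 / (real r * ?m x)"
      using r by (simp add: emp_def field_simps power2_eq_square)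
  qed
  finally show ?thesis .
qed

text \<open>In degree 1 the transform depends on the sample only through the sample means, linearly.
  The dual relation, applied after adding the missing term \<open>l = 0\<close>, evaluates the sum
  of squares.\<close>

lemma emp_power_1:
  assumes N: "1 \<le> N"
  shows "emp_power d N u r X 1 = (\<Sum>j=1..d. (sample_mean d N r X j - real N * p j)\<^sup>2 / (real N * p j))"
proof -
  let ?m = "sample_mean d N r X"
  have sm: "(\<Sum>j=1..d. ?m j) = real N"
  proof -
    have "(\<Sum>j=1..d. ?m j) = (\<Sum>x\<in>weak_comps d N. real (\<Sum>j=1..d. Poly_Mapping.lookup x j) * emp r X x)"
      unfolding sample_mean_def by (subst sum.swap) (simp add: sum_distrib_right)
    also have "\<dots> = (\<Sum>x\<in>weak_comps d N. real N * emp r X x)"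
      by (intro sum.cong refl) (simp add: weak_comps_def)
    finally show ?thesis by (simp add: sum_distrib_left[symmetric] sum_emp_eq_1)
  qed
  have tr: "(emp_transform d N u r X (Poly_Mapping.single l 1))\<^sup>2 = (\<Sum>j=1..d. ?m j * u l j)\<^sup>2 / N"
    if l: "l \<in> {1..d-1}" for l
  proof -
    have prod: "(\<Prod>l'=1..d-1. fact (Poly_Mapping.lookup (Poly_Mapping.single l 1) l') :: real) = 1"
      by (intro prod.neutral) (auto simp: lookup_single when_def)
    have sum: "(\<Sum>l'=1..d-1. Poly_Mapping.lookup (Poly_Mapping.single l 1) l') = (1::nat)"
      using l by (simp add: lookup_single when_def)
    have ic: "index_coeff d N (Poly_Mapping.single l 1) = real N"
      unfolding index_coeff_def prod sum using N by (cases N) auto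
    have "emp_transform d N u r X (Poly_Mapping.single l 1)
        = real N powr (- 1 / 2) * (\<Sum>x\<in>weak_comps d N. (\<Sum>j=1..d. real (Poly_Mapping.lookup x j) * u l j) * emp r X x)"
      unfolding emp_transform_def krawtchouk_on_def ic sum_distrib_left mult.assoc
      by (intro sum.cong refl) (simp add: krawtchouk_degree_1[OF _ l, unfolded One_nat_def])
    also have "(\<Sum>x\<in>weak_comps d N. (\<Sum>j=1..d. real (Poly_Mapping.lookup x j) * u l j) * emp r X x)
        = (\<Sum>j=1..d. ?m j * u l j)"
      unfolding sample_mean_def sum_distrib_right by (subst sum.swap) (simp add: mult_ac)
    finally have "(emp_transform d N u r X (Poly_Mapping.single l 1))\<^sup>2
        = (real N powr (- 1 / 2) * real N powr (- 1 / 2)) * (\<Sum>j=1..d. ?m j * u l j)\<^sup>2"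
      by (simp add: power2_eq_square mult_ac)
    also have "real N powr (- 1 / 2) * real N powr (- 1 / 2) = 1 / real N"
      using N by (simp add: powr_add[symmetric] powr_minus_divide)
    finally show ?thesis by simp
  qed
  have "emp_power d N u r X 1 = (\<Sum>l=1..d-1. (\<Sum>j=1..d. ?m j * u l j)\<^sup>2 / N)"
    unfolding emp_power_def weak_comps_1
  proof (subst sum.reindex)
    show "inj_on (\<lambda>l. Poly_Mapping.single l (1::nat)) {1..d-1}"
      by (rule inj_onI) (metis lookup_single_eq lookup_single_not_eq zero_neq_one)
  qed (simp add: tr[unfolded One_nat_def])
  \<comment> \<open>The added term is the square of the sum of all sample means, which is
    \<open>N\<close> because every configuration holds \<open>N\<close> balls.\<close>
  also have "\<dots> = ((\<Sum>l<d. (\<Sum>j=1..d. ?m j * u l j)\<^sup>2) - (real N)\<^sup>2) / N"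
  proof -
    have "(\<Sum>j=1..d. ?m j * u 0 j) = real N" unfolding sm[symmetric] by (intro sum.cong) (auto simp: u_0)
    thus ?thesis unfolding letters by (simp add: sum_divide_distrib)
  qed
  also have "(\<Sum>l<d. (\<Sum>j=1..d. ?m j * u l j)\<^sup>2) = (\<Sum>j=1..d. (?m j)\<^sup>2 / p j)"
  proof -
    have "(\<Sum>l<d. (\<Sum>j=1..d. ?m j * u l j)\<^sup>2) = (\<Sum>l<d. \<Sum>j=1..d. \<Sum>j'=1..d. (?m j * ?m j') * (u l j * u l j'))"
      by (simp only: power2_eq_square sum_product mult_ac)
    also have "\<dots> = (\<Sum>j=1..d. \<Sum>j'=1..d. \<Sum>l<d. (?m j * ?m j') * (u l j * u l j'))"
      by (rule sum_rotate)
    also have "\<dots> = (\<Sum>j=1..d. \<Sum>j'=1..d. if j = j' then (?m j)\<^sup>2 / p j else 0)"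
      by (intro sum.cong refl) (simp add: sum_distrib_left[symmetric] dual_orthonormal power2_eq_square)
    finally show ?thesis by simp
  qed
  \<comment> \<open>Again a completion of the square: the sample means add up to \<open>N\<close>
    and the \<open>p j\<close> to 1.\<close>
  also have "((\<Sum>j=1..d. (?m j)\<^sup>2 / p j) - (real N)\<^sup>2) / N
      = ((\<Sum>j=1..d. (?m j)\<^sup>2 / p j) - 2 * real N * (\<Sum>j=1..d. ?m j) + (real N)\<^sup>2 * (\<Sum>j=1..d. p j)) / N"
    unfolding sm p_sum by (simp add: power2_eq_square)
  also have "\<dots> = (\<Sum>j=1..d. ((?m j)\<^sup>2 / p j - 2 * real N * ?m j + (real N)\<^sup>2 * p j) / N)"
    by (simp add: sum_distrib_left sum.distrib sum_subtractf sum_divide_distrib[symmetric])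
  also have "\<dots> = (\<Sum>j=1..d. (?m j - real N * p j)\<^sup>2 / (real N * p j))"
    using N less_imp_neq[OF p_pos]
    by (intro sum.cong refl) (simp add: field_simps power2_eq_square)
  finally show ?thesis .
qed

end
end

text \<open>Both kernels equal the average in \<open>krawtchouk_kernel_eq\<close>, taken at the same
  word of type \<open>y\<close>.\<close>

lemma krawtchouk_kernel_basis_independent:
  assumes "krawtchouk_basis d p u" "krawtchouk_basis d p v"
    and x: "x \<in> weak_comps d N" and y: "y \<in> weak_comps d N" and "i \<le> N"
  shows "krawtchouk_kernel d N u i x y = krawtchouk_kernel d N v i x y"
proof -
  obtain a' where "a' \<in> typed_words N {1..d} y"
    using y by (auto simp: weak_comps_eq_image typed_words_def)
  thus ?thesis
    using krawtchouk_basis.krawtchouk_kernel_eq[OF assms(1) x _ \<open>i \<le> N\<close>]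
      krawtchouk_basis.krawtchouk_kernel_eq[OF assms(2) x _ \<open>i \<le> N\<close>] by simp
qed

subsection \<open>The limit law\<close>

text \<open>Used to renumber the sample from 0. Injectivity makes a finite subfamily correspond to
  distinct members of the original family, so the product formula carries over.\<close>

lemma (in prob_space) indep_vars_reindex_inj:
  assumes inj: "inj_on f I" and indep: "indep_vars M' X (f ` I)"
  shows "indep_vars (\<lambda>i. M' (f i)) (\<lambda>i. X (f i)) I"
proof -
  define F where "F i = {X i -` A \<inter> space M |A. A \<in> sets (M' i)}" for i
  have rv: "\<forall>i\<in>f ` I. random_variable (M' i) (X i)" and sets: "indep_sets F (f ` I)"
    using indep unfolding indep_vars_def2 F_def by auto
  have "indep_sets (\<lambda>i. F (f i)) I"
  proof (rule indep_setsI)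
    show "F (f i) \<subseteq> events" if "i \<in> I" for i
      using sets that unfolding indep_sets_def by blast
    fix A J assume J: "J \<noteq> {}" "J \<subseteq> I" "finite J" "\<forall>j\<in>J. A j \<in> F (f j)"
    have inj': "inj_on f J" using inj J(2) by (rule inj_on_subset)
    \<comment> \<open>The original family is indexed by the image, so the chosen events are
      transported along the inverse of \<open>f\<close> on \<open>J\<close>.\<close>
    define A' where "A' = A \<circ> the_inv_into J f"
    have A': "A' (f j) = A j" if "j \<in> J" for j
      using that inj' by (simp add: A'_def the_inv_into_f_f)
    have "prob (\<Inter>j\<in>f ` J. A' j) = (\<Prod>j\<in>f ` J. prob (A' j))"
      by (rule indep_setsD[OF sets]) (use J A' in auto)
    thus "prob (\<Inter>j\<in>J. A j) = (\<Prod>j\<in>J. prob (A j))"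
      using A' inj' by (simp add: prod.reindex)
  qed
  with rv show ?thesis unfolding indep_vars_def2 F_def by auto
qed

section \<open>The chi-squared distribution and its Laplace transform\<close>

lemma measurable_sum_squares_std_normal [measurable]:
  "(\<lambda>z. \<Sum>i<k. (z i)\<^sup>2) \<in> borel_measurable (\<Pi>\<^sub>M i\<in>{..<k :: nat}. std_normal_distribution)"
proof -
  have "(\<lambda>z. z i) \<in> borel_measurable (\<Pi>\<^sub>M i\<in>{..<k}. std_normal_distribution)" if "i < k" for i
    using measurable_component_singleton[of i "{..<k}" "\<lambda>_. std_normal_distribution"] that by simp
  thus ?thesis by (intro borel_measurable_sum borel_measurable_power) simp
qed

lemma sets_chi_squared_distribution [simp, measurable_cong]:
  "sets (chi_squared_distribution k) = sets borel"
  by (simp add: chi_squared_distribution_def)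

lemma prob_space_chi_squared_distribution: "prob_space (chi_squared_distribution k)"
proof -
  interpret N: real_distribution std_normal_distribution by (rule real_dist_normal_dist)
  interpret product_prob_space "\<lambda>_ :: nat. std_normal_distribution" "{..<k}" by standard
  show ?thesis unfolding chi_squared_distribution_def by (rule prob_space_distr) measurable
qed

lemma AE_chi_squared_distribution_nonneg: "AE y in chi_squared_distribution k. 0 \<le> y"
  unfolding chi_squared_distribution_def by (subst AE_distr_iff) (auto intro!: AE_I2 sum_nonneg)

text \<open>The exponential turns the sum of squares into a product, which the product measure
  integrates factor by factor. The one-dimensional integral stays unevaluated because the same
  integral arises as the limit for the sample.\<close>

lemma integral_exp_chi_squared_distribution:
  "(\<integral>y. exp (- y) ^ j \<partial>chi_squared_distribution k) = (\<integral>x. exp (- x\<^sup>2) ^ j \<partial>std_normal_distribution) ^ k"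
proof -
  interpret N: real_distribution std_normal_distribution by (rule real_dist_normal_dist)
  interpret product_prob_space "\<lambda>_ :: nat. std_normal_distribution" "{..<k}" by standard
  have "(\<integral>y. exp (- y) ^ j \<partial>chi_squared_distribution k)
      = (\<integral>z. exp (- (\<Sum>i<k. (z i)\<^sup>2)) ^ j \<partial>(\<Pi>\<^sub>M i\<in>{..<k}. std_normal_distribution))"
    unfolding chi_squared_distribution_def by (rule integral_distr) measurable
  also have "\<dots> = (\<integral>z. (\<Prod>i<k. exp (- (z i)\<^sup>2) ^ j) \<partial>(\<Pi>\<^sub>M i\<in>{..<k}. std_normal_distribution))"
    by (simp add: exp_sum sum_negf[symmetric] prod_power_distrib)
  also have "\<dots> = (\<Prod>i<k. \<integral>x. exp (- x\<^sup>2) ^ j \<partial>std_normal_distribution)"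
  proof (rule product_integral_prod)
    show "integrable std_normal_distribution (\<lambda>x. exp (- x\<^sup>2) ^ j)"
      by (rule N.integrable_const_bound[of _ 1]) (auto intro!: AE_I2 power_le_one)
  qed simp
  finally show ?thesis by simp
qed

lemma integrable_exp_chi_squared_distribution:
  "integrable (chi_squared_distribution k) (\<lambda>y. exp (- y) ^ j)"
proof -
  interpret chi: prob_space "chi_squared_distribution k" by (rule prob_space_chi_squared_distribution)
  show ?thesis
  proof (rule chi.integrable_const_bound[of _ 1])
    show "AE y in chi_squared_distribution k. norm (exp (- y) ^ j) \<le> 1"
      using AE_chi_squared_distribution_nonneg by eventually_elim (auto intro!: power_le_one)
  qed measurable
qed

lemma integral_multinomial_measure:
  assumes "\<And>x. x \<in> weak_comps d N \<Longrightarrow> 0 \<le> multinomial d N p x"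
  shows "(\<integral>x. f x \<partial>multinomial_measure d N p) = (\<Sum>x\<in>weak_comps d N. multinomial d N p x * (f x :: real))"
  unfolding multinomial_measure_def
  by (subst lebesgue_integral_point_measure_finite) (use assms in auto)

text \<open>Recovers the degree from a multi-index. This makes the levels disjoint and lets a weight
  chosen per degree be indexed by the multi-index alone.\<close>

definition degree_of :: "nat \<Rightarrow> (nat \<Rightarrow>\<^sub>0 nat) \<Rightarrow> nat" where
  "degree_of m n = (\<Sum>l=1..m. Poly_Mapping.lookup n l)"

lemma degree_of_weak_comps: "n \<in> weak_comps m i \<Longrightarrow> degree_of m n = i"
  by (simp add: degree_of_def weak_comps_def)

lemma prod_weak_comps_UN:
  "(\<Prod>n\<in>(\<Union>i\<in>{1..N}. weak_comps m i). f n) = (\<Prod>i\<in>{1..N}. \<Prod>n\<in>weak_comps m i. f n)"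
  by (rule prod.UNION_disjoint) (auto dest: degree_of_weak_comps)

text \<open>Each component is the sum of the squares of the normalised sums
  \<open>Z r \<omega> n\<close> over the indices \<open>n\<close> of degree \<open>i\<close>. These
  sums become independent standard normals, and the levels partition the index set
  \<open>B\<close>.\<close>

lemma (in krawtchouk_basis) emp_power_asymptotics:
  assumes d: "2 \<le> d" and M: "prob_space M"
    and indep: "prob_space.indep_vars M (\<lambda>_. count_space (weak_comps d N)) X {1..}"
    and dist: "\<And>k. 1 \<le> k \<Longrightarrow> distr M (count_space (weak_comps d N)) (X k) = multinomial_measure d N p"
  shows "joint_weak_conv {1..N}
    (\<lambda>r. distr M (\<Pi>\<^sub>M i\<in>{1..N}. borel) (\<lambda>\<omega>. \<lambda>i\<in>{1..N}. real r * emp_power d N u r (\<lambda>k. X k \<omega>) i))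
    (\<Pi>\<^sub>M i\<in>{1..N}. chi_squared_distribution ((i + d - 2) choose (d - 2)))"
proof -
  interpret M: prob_space M by fact
  let ?S = "count_space (weak_comps d N)" and ?I = "{1..N}"
  define q where "q = krawtchouk_on d N u"
  define B where "B = (\<Union>i\<in>?I. weak_comps (d - 1) i)"
  have "finite B" by (auto simp: B_def)
  \<comment> \<open>The sample is numbered from 1, the central limit theorem sums over
    \<open>k < r\<close>.\<close>
  define Y where "Y k = X (Suc k)" for k
  have Y_indep: "M.indep_vars (\<lambda>_. ?S) Y UNIV"
  proof -
    have "range Suc = {1..}" by (auto simp: image_iff Suc_le_eq gr0_conv_Suc)
    thus ?thesis
      unfolding Y_def[abs_def] using M.indep_vars_reindex_inj[of Suc UNIV "\<lambda>_. ?S" X] indep by simp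
  qed
  have X_meas: "X k \<in> measurable M ?S" if "1 \<le> k" for k
    using indep that unfolding M.indep_vars_def by auto
  have X_in: "X k \<omega> \<in> weak_comps d N" if "1 \<le> k" "\<omega> \<in> space M" for k \<omega>
    using measurable_space[OF X_meas[OF that(1)] that(2)] by simp
  have int: "(\<integral>x. f x \<partial>multinomial_measure d N p) = (\<Sum>x\<in>weak_comps d N. multinomial d N p x * f x)"
    for f :: "(nat \<Rightarrow>\<^sub>0 nat) \<Rightarrow> real"
    using multinomial_pos by (intro integral_multinomial_measure less_imp_le)
  define Z where "Z r \<omega> n = (\<Sum>k<r. q n (Y k \<omega>)) / sqrt (real r)" for r \<omega> n
  have Z_meas: "(\<lambda>\<omega>. Z r \<omega> n) \<in> borel_measurable M" for r n
  proof -
    have "(\<lambda>\<omega>. q n (Y k \<omega>)) \<in> borel_measurable M" for k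
      using measurable_compose[OF X_meas[of "Suc k"], of "q n" borel] by (simp add: Y_def)
    thus ?thesis unfolding Z_def by measurable
  qed
  have char: "(\<lambda>r. \<integral>\<omega>. iexp (\<Sum>n\<in>B. s n * Z r \<omega> n) \<partial>M) \<longlonglongrightarrow> of_real (exp (- (\<Sum>n\<in>B. (s n)\<^sup>2) / 2))" for s
    unfolding Z_def
  proof (rule M.multivariate_clt_char[OF Y_indep _ finite_weak_comps \<open>finite B\<close>])
    show "distr M ?S (Y k) = multinomial_measure d N p" for k
      using dist[of "Suc k"] by (simp add: Y_def)
    fix n assume "n \<in> B"
    then obtain i where i: "n \<in> weak_comps (d - 1) i" "1 \<le> i" "i \<le> N" by (auto simp: B_def)
    \<comment> \<open>Degree at least 1 separates \<open>n\<close> from the index of the constant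
      polynomial; orthogonality to that constant is the vanishing of the mean.\<close>
    have "n \<noteq> 0" using i by (auto simp: weak_comps_def)
    have "(\<Sum>x\<in>weak_comps d N. multinomial d N p x * (q n x * krawtchouk_on d N u 0 x)) = 0"
      unfolding q_def using krawtchouk_on_orthonormal[OF i(1,3), of 0 0] \<open>n \<noteq> 0\<close> by (simp add: weak_comps_0)
    thus "(\<integral>x. q n x \<partial>multinomial_measure d N p) = 0"
      unfolding int by (simp add: krawtchouk_on_0 cong: sum.cong_simp)
    fix n' assume "n' \<in> B"
    then obtain i' where i': "n' \<in> weak_comps (d - 1) i'" "i' \<le> N" by (auto simp: B_def)
    show "(\<integral>x. q n x * q n' x \<partial>multinomial_measure d N p) = of_bool (n = n')"
      unfolding int q_def by (rule krawtchouk_on_orthonormal[OF i(1,3) i'])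
  qed
  define T where "T r \<omega> i = real r * emp_power d N u r (\<lambda>k. X k \<omega>) i" for r \<omega> i
  \<comment> \<open>The factor \<open>r\<close> turns the squared sample mean of \<open>q n\<close>
    into the square of the sum divided by \<open>sqrt r\<close>; for \<open>r = 0\<close> both sides
    are 0.\<close>
  have T_eq: "T r \<omega> i = (\<Sum>n\<in>weak_comps (d - 1) i. (Z r \<omega> n)\<^sup>2)" if \<omega>: "\<omega> \<in> space M" for r \<omega> i
  proof -
    have "emp_transform d N u r (\<lambda>k. X k \<omega>) n = (\<Sum>k<r. q n (Y k \<omega>)) / real r" for n
    proof -
      have "emp_transform d N u r (\<lambda>k. X k \<omega>) n = (\<Sum>k=1..r. q n (X k \<omega>)) / real r"
        unfolding emp_transform_def q_def
        by (rule sum_emp[OF finite_weak_comps]) (use X_in \<omega> in auto)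
      thus ?thesis by (simp add: Y_def sum.atLeast1_atMost_eq)
    qed
    hence "T r \<omega> i = (\<Sum>n\<in>weak_comps (d - 1) i. real r * ((\<Sum>k<r. q n (Y k \<omega>)) / real r)\<^sup>2)"
      unfolding T_def emp_power_def power2_abs sum_distrib_left by simp
    also have "\<dots> = (\<Sum>n\<in>weak_comps (d - 1) i. (Z r \<omega> n)\<^sup>2)"
      by (intro sum.cong refl) (simp add: Z_def power_divide power2_eq_square)
    finally show ?thesis .
  qed
  have T_meas1: "(\<lambda>\<omega>. T r \<omega> i) \<in> borel_measurable M" for r i
    using Z_meas by (subst measurable_cong[OF T_eq]) auto
  have T_meas: "(\<lambda>\<omega>. \<lambda>i\<in>?I. T r \<omega> i) \<in> measurable M (\<Pi>\<^sub>M i\<in>?I. borel)" for r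
    by (intro measurable_restrict T_meas1)
  define g where "g k = (\<integral>x. exp (- x\<^sup>2) ^ k \<partial>std_normal_distribution)" for k :: nat
  define C where "C i = chi_squared_distribution ((i + d - 2) choose (d - 2))" for i
  interpret C: product_prob_space C ?I
    unfolding C_def product_prob_space_def product_prob_space_axioms_def product_sigma_finite_def
    using prob_space_chi_squared_distribution prob_space_imp_sigma_finite by blast
  show ?thesis
    unfolding T_def[symmetric] C_def[symmetric]
  proof (rule joint_weak_conv_of_laplace)
    show "prob_space (distr M (\<Pi>\<^sub>M i\<in>?I. borel) (\<lambda>\<omega>. \<lambda>i\<in>?I. T r \<omega> i))" for r
      by (rule M.prob_space_distr[OF T_meas])
    show "AE y in distr M (\<Pi>\<^sub>M i\<in>?I. borel) (\<lambda>\<omega>. \<lambda>i\<in>?I. T r \<omega> i). \<forall>i\<in>?I. 0 \<le> y i" for r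
    proof (subst AE_distr_iff[OF T_meas])
      show "{y \<in> space (\<Pi>\<^sub>M i\<in>?I. borel). \<forall>i\<in>?I. (0 :: real) \<le> y i} \<in> sets (\<Pi>\<^sub>M i\<in>?I. borel)"
        by measurable
      show "AE \<omega> in M. \<forall>i\<in>?I. 0 \<le> (\<lambda>i\<in>?I. T r \<omega> i) i"
        by (auto simp: T_eq intro!: AE_I2 sum_nonneg)
    qed
    show "prob_space (Pi\<^sub>M ?I C)" by (rule C.prob_space_axioms)
    show "sets (Pi\<^sub>M ?I C) = sets (\<Pi>\<^sub>M i\<in>?I. borel)"
      by (intro sets_PiM_cong refl) (simp add: C_def)
    show "AE y in Pi\<^sub>M ?I C. \<forall>i\<in>?I. 0 \<le> y i"
    proof (subst AE_ball_countable)
      show "\<forall>i\<in>?I. AE y in Pi\<^sub>M ?I C. 0 \<le> y i"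
        unfolding C_def
        by (intro ballI AE_PiM_component prob_space_chi_squared_distribution AE_chi_squared_distribution_nonneg)
    qed simp
    fix k :: "nat \<Rightarrow> nat"
    \<comment> \<open>Chosen so that \<open>(c n)\<^sup>2 / 2\<close> is the exponent
      \<open>k i\<close> for \<open>n\<close> of degree \<open>i\<close>. A power of the exponential
      of one component then splits into the Gaussian factors of its indices.\<close>
    define c where "c n = sqrt (2 * real (k (degree_of (d - 1) n)))" for n
    have gauss: "exp (- x\<^sup>2) ^ k i = exp (- (c n * x)\<^sup>2 / 2)" if "n \<in> weak_comps (d - 1) i" for x n i
      using degree_of_weak_comps[OF that]
      by (simp add: c_def power_mult_distrib exp_of_nat_mult[symmetric])
    have "(\<lambda>r. \<integral>\<omega>. (\<Prod>n\<in>B. exp (- (c n * Z r \<omega> n)\<^sup>2 / 2)) \<partial>M)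
        \<longlonglongrightarrow> (\<Prod>n\<in>B. \<integral>x. exp (- (c n * x)\<^sup>2 / 2) \<partial>std_normal_distribution)"
      by (rule tendsto_integral_prod_gaussian_of_char[OF M \<open>finite B\<close> Z_meas char])
    moreover have "(\<integral>\<omega>. (\<Prod>n\<in>B. exp (- (c n * Z r \<omega> n)\<^sup>2 / 2)) \<partial>M)
        = (\<integral>y. (\<Prod>i\<in>?I. exp (- y i) ^ k i) \<partial>distr M (\<Pi>\<^sub>M i\<in>?I. borel) (\<lambda>\<omega>. \<lambda>i\<in>?I. T r \<omega> i))" for r
    proof -
      have "(\<integral>y. (\<Prod>i\<in>?I. exp (- y i) ^ k i) \<partial>distr M (\<Pi>\<^sub>M i\<in>?I. borel) (\<lambda>\<omega>. \<lambda>i\<in>?I. T r \<omega> i))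
          = (\<integral>\<omega>. (\<Prod>i\<in>?I. exp (- (\<lambda>i\<in>?I. T r \<omega> i) i) ^ k i) \<partial>M)"
        by (rule integral_distr[OF T_meas]) measurable
      also have "\<dots> = (\<integral>\<omega>. (\<Prod>n\<in>B. exp (- (c n * Z r \<omega> n)\<^sup>2 / 2)) \<partial>M)"
      proof (rule Bochner_Integration.integral_cong[OF refl])
        fix \<omega> assume \<omega>: "\<omega> \<in> space M"
        have "exp (- T r \<omega> i) ^ k i = (\<Prod>n\<in>weak_comps (d - 1) i. exp (- (c n * Z r \<omega> n)\<^sup>2 / 2))" for i
        proof -
          have "exp (- T r \<omega> i) ^ k i = (\<Prod>n\<in>weak_comps (d - 1) i. exp (- (Z r \<omega> n)\<^sup>2) ^ k i)"
            unfolding T_eq[OF \<omega>] by (simp add: exp_sum sum_negf[symmetric] prod_power_distrib)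
          also have "\<dots> = (\<Prod>n\<in>weak_comps (d - 1) i. exp (- (c n * Z r \<omega> n)\<^sup>2 / 2))"
            by (rule prod.cong[OF refl gauss])
          finally show ?thesis .
        qed
        hence "(\<Prod>i\<in>?I. exp (- T r \<omega> i) ^ k i) = (\<Prod>n\<in>B. exp (- (c n * Z r \<omega> n)\<^sup>2 / 2))"
          unfolding B_def prod_weak_comps_UN by simp
        thus "(\<Prod>i\<in>?I. exp (- (\<lambda>i\<in>?I. T r \<omega> i) i) ^ k i) = (\<Prod>n\<in>B. exp (- (c n * Z r \<omega> n)\<^sup>2 / 2))"
          by (simp cong: prod.cong_simp)
      qed
      finally show ?thesis by simp
    qed
    moreover have "(\<Prod>n\<in>B. \<integral>x. exp (- (c n * x)\<^sup>2 / 2) \<partial>std_normal_distribution)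
        = (\<integral>y. (\<Prod>i\<in>?I. exp (- y i) ^ k i) \<partial>Pi\<^sub>M ?I C)"
    proof -
      have "(\<integral>y. (\<Prod>i\<in>?I. exp (- y i) ^ k i) \<partial>Pi\<^sub>M ?I C) = (\<Prod>i\<in>?I. \<integral>y. exp (- y) ^ k i \<partial>C i)"
        unfolding C_def
        by (rule C.product_integral_prod[unfolded C_def]) (simp_all add: integrable_exp_chi_squared_distribution)
      also have "\<dots> = (\<Prod>i\<in>?I. g (k i) ^ card (weak_comps (d - 1) i))"
      proof (rule prod.cong[OF refl])
        fix i assume "i \<in> ?I"
        \<comment> \<open>Here \<open>2 \<le> d\<close> enters: \<open>card_weak_comps\<close> is
          applied with \<open>m = d - 1\<close>, which must be at least 1.\<close>
        have "card (weak_comps (d - 1) i) = (i + d - 2) choose (d - 2)"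
          using card_weak_comps[of "d - 1" i] d by (simp add: numeral_2_eq_2)
        thus "(\<integral>y. exp (- y) ^ k i \<partial>C i) = g (k i) ^ card (weak_comps (d - 1) i)"
          by (simp add: C_def integral_exp_chi_squared_distribution g_def)
      qed
      also have "\<dots> = (\<Prod>i\<in>?I. \<Prod>n\<in>weak_comps (d - 1) i. \<integral>x. exp (- (c n * x)\<^sup>2 / 2) \<partial>std_normal_distribution)"
      proof (rule prod.cong[OF refl])
        fix i
        have "(\<Prod>n\<in>weak_comps (d - 1) i. \<integral>x. exp (- (c n * x)\<^sup>2 / 2) \<partial>std_normal_distribution)
            = (\<Prod>n\<in>weak_comps (d - 1) i. g (k i))"
          by (rule prod.cong[OF refl]) (simp only: g_def gauss)
        thus "g (k i) ^ card (weak_comps (d - 1) i)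
            = (\<Prod>n\<in>weak_comps (d - 1) i. \<integral>x. exp (- (c n * x)\<^sup>2 / 2) \<partial>std_normal_distribution)"
          by simp
      qed
      finally show ?thesis unfolding B_def prod_weak_comps_UN ..
    qed
    ultimately show "(\<lambda>r. \<integral>y. (\<Prod>i\<in>?I. exp (- y i) ^ k i) \<partial>distr M (\<Pi>\<^sub>M i\<in>?I. borel) (\<lambda>\<omega>. \<lambda>i\<in>?I. T r \<omega> i))
        \<longlonglongrightarrow> (\<integral>y. (\<Prod>i\<in>?I. exp (- y i) ^ k i) \<partial>Pi\<^sub>M ?I C)" by simp
  qed simp_all
qed

theorem theorem2:
  fixes d N :: nat
    and p :: "nat \<Rightarrow> real"
    and u :: "nat \<Rightarrow> nat \<Rightarrow> real"
    and M :: "'w measure"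
  assumes "2 \<le> d" and "1 \<le> N"
    and "\<forall>j\<in>{1..d}. 0 < p j" and "(\<Sum>j=1..d. p j) = 1"
    and "orthonormal_basis d p u"
  shows
    "(\<forall>r \<ge> 1. \<forall>X :: nat \<Rightarrow> (nat \<Rightarrow>\<^sub>0 nat). (\<forall>k\<in>{1..r}. X k \<in> weak_comps d N) \<longrightarrow>
        (\<forall>i\<in>{1..N}. \<forall>v. orthonormal_basis d p v \<longrightarrow>
           emp_power d N u r X i =
             (\<Sum>x\<in>weak_comps d N. \<Sum>y\<in>weak_comps d N.
                krawtchouk_kernel d N v i x y * emp r X x * emp r X y)) \<and>
        (\<Sum>i=1..N. real r * emp_power d N u r X i) =
           chi_square_stat (weak_comps d N) (multinomial d N p) r X \<and>
        real r * emp_power d N u r X 1 =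
           real r * (\<Sum>j=1..d. (sample_mean d N r X j - real N * p j)\<^sup>2 / (real N * p j))) \<and>
     (\<forall>X :: nat \<Rightarrow> 'w \<Rightarrow> (nat \<Rightarrow>\<^sub>0 nat).
        prob_space M \<longrightarrow>
        prob_space.indep_vars M (\<lambda>_. count_space (weak_comps d N)) X {1..} \<longrightarrow>
        (\<forall>k\<ge>1. distr M (count_space (weak_comps d N)) (X k) = multinomial_measure d N p) \<longrightarrow>
        joint_weak_conv {1..N}
          (\<lambda>r. distr M (\<Pi>\<^sub>M i\<in>{1..N}. borel)
             (\<lambda>\<omega>. \<lambda>i\<in>{1..N}. real r * emp_power d N u r (\<lambda>k. X k \<omega>) i))
          (\<Pi>\<^sub>M i\<in>{1..N}. chi_squared_distribution ((i + d - 2) choose (d - 2))))"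
proof -
  have kb: "krawtchouk_basis d p v" if "orthonormal_basis d p v" for v
    using assms(1,3,4) that by unfold_locales auto
  interpret krawtchouk_basis d N p u by (rule kb[OF assms(5)])
  show ?thesis
  proof (intro conjI allI impI ballI)
    fix r :: nat and X :: "nat \<Rightarrow> (nat \<Rightarrow>\<^sub>0 nat)"
    assume r: "1 \<le> r" and "\<forall>k\<in>{1..r}. X k \<in> weak_comps d N"
    hence X: "\<And>k. k \<in> {1..r} \<Longrightarrow> X k \<in> weak_comps d N" by blast
    show "emp_power d N u r X i = (\<Sum>x\<in>weak_comps d N. \<Sum>y\<in>weak_comps d N.
        krawtchouk_kernel d N v i x y * emp r X x * emp r X y)"
      if i: "i \<in> {1..N}" and v: "orthonormal_basis d p v" for i v
    proof -
      have "krawtchouk_kernel d N u i x y = krawtchouk_kernel d N v i x y"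
        if "x \<in> weak_comps d N" "y \<in> weak_comps d N" for x y
        using krawtchouk_kernel_basis_independent[OF kb[OF assms(5)] kb[OF v] that] i by simp
      thus ?thesis unfolding emp_power_eq_kernel by (intro sum.cong refl) simp
    qed
    show "(\<Sum>i=1..N. real r * emp_power d N u r X i) =
        chi_square_stat (weak_comps d N) (multinomial d N p) r X"
      by (rule sum_emp_power[OF r X])
    show "real r * emp_power d N u r X 1 =
        real r * (\<Sum>j=1..d. (sample_mean d N r X j - real N * p j)\<^sup>2 / (real N * p j))"
      by (subst emp_power_1[OF r X assms(2)]) simp_all
  next
    fix X :: "nat \<Rightarrow> 'w \<Rightarrow> (nat \<Rightarrow>\<^sub>0 nat)"
    assume "prob_space M" "prob_space.indep_vars M (\<lambda>_. count_space (weak_comps d N)) X {1..}"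
      "\<forall>k\<ge>1. distr M (count_space (weak_comps d N)) (X k) = multinomial_measure d N p"
    thus "joint_weak_conv {1..N}
          (\<lambda>r. distr M (\<Pi>\<^sub>M i\<in>{1..N}. borel)
             (\<lambda>\<omega>. \<lambda>i\<in>{1..N}. real r * emp_power d N u r (\<lambda>k. X k \<omega>) i))
          (\<Pi>\<^sub>M i\<in>{1..N}. chi_squared_distribution ((i + d - 2) choose (d - 2)))"
      by (intro emp_power_asymptotics[OF assms(1)]) auto
  qed
qed

end
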